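(* Let $X$ be a separable real Fréchet space whose topology is given by a countable system of norms $\{p_n\}_{n\in\mathbb{N}}$, and let $Y$ be a (real) Banach space. Suppose that for every $n\in\mathbb{N}$ the normed space $X_n=(X,p_n)$ admits a uniformly analytic and separating function. Let $f:X\to Y$ be a uniformly continuous function for which there exists $k\in\mathbb{N}$ such that $f$ is uniformly continuous on $X_k=(X,p_k)$. Then $f$ is approximated by analytic functions uniformly on all of $X$: for every $\varepsilon>0$ there is an analytic map $H:X\to Y$ such that $\|f(x)-H(x)\|<\varepsilon$ for all $x\in X$.
   Context: A Fréchet space is a locally convex topological vector space metrizable by a complete metric. "With a countable system of norms $\{p_n\}$" means that each $p_n$ is a norm on $X$, that the topology of $X$ is the weakest one for which all $p_n$ are continuous, and that the metric $\rho(x,y)=\sum_n 2^{-n}\frac{p_n(x-y)}{1+p_n(x-y)}$ is complete. $X_n=(X,p_n)$ is the vector space $X$ with the single norm $p_n$ (not necessarily complete). Uniform continuity on $X$ is with respect to $\rho$, and on $X_k$ with respect to $p_k$. An $n$-homogeneous polynomial $F_n$ from a vector space $X$ to a vector space $Y$ is a map $F_n(x)=B_n(x,\dots,x)$ with $B_n:X^n\to Y$ $n$-linear (for $n=0$, a constant). A map $F:X\to Y$ from a topological vector space $X$ to a normed space $Y$ is analytic if for every $x\in X$ there are a neighbourhood $V$ of $0$ in $X$ and continuous $n$-homogeneous polynomials $F_n:X\to Y$ ($n\ge 0$) such that $F(x+h)=\sum_{n=0}^\infty F_n(h)$ for $h\in V$, the series converging uniformly on $V$ in the norm of $Y$. A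 function $Q:Z\to\mathbb{R}$ on a real normed space $Z$ is uniformly analytic and separating if: (1) $Q$ is real analytic on $Z$ and there is $R_Q>0$ such that at every point $x\in Z$ the radius of convergence of the power series of $Q$ at $x$ is at least $R_Q$ (the radius of convergence of $\sum_n F_n(h)$ being the supremum of $r>0$ such that the series converges uniformly for $\|h\|\le r$); (2) there is $\alpha\in\mathbb{R}$ such that the set $\{x\in Z: Q(x)<\alpha\}$ is nonempty and contained in the open unit ball of $Z$. *)

theory Defs
  imports "HOL-Analysis.Analysis"
begin

section \<open>Norms and Frechet spaces\<close>

text \<open>
  One vector space carries many norms here, so norms and topologies are explicit parameters on
  the underlying real vector space (the whole type \<open>'a\<close>) rather than type class operations.
\<close>

definition is_norm :: "('a::real_vector \<Rightarrow> real) \<Rightarrow> bool" where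
  "is_norm q \<longleftrightarrow>
     (\<forall>x. q x = 0 \<longleftrightarrow> x = 0) \<and>
     (\<forall>a x. q (a *\<^sub>R x) = \<bar>a\<bar> * q x) \<and>
     (\<forall>x y. q (x + y) \<le> q x + q y)"

definition norm_metric :: "('a::real_vector \<Rightarrow> real) \<Rightarrow> 'a metric" where
  "norm_metric q = metric (UNIV, \<lambda>x y. q (x - y))"

definition frechet_dist :: "(nat \<Rightarrow> 'a::real_vector \<Rightarrow> real) \<Rightarrow> 'a \<Rightarrow> 'a \<Rightarrow> real" where
  "frechet_dist p x y = (\<Sum>n. (1 / 2) ^ n * (p n (x - y) / (1 + p n (x - y))))"

definition frechet_metric :: "(nat \<Rightarrow> 'a::real_vector \<Rightarrow> real) \<Rightarrow> 'a metric" where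
  "frechet_metric p = metric (UNIV, frechet_dist p)"

definition vector_topology :: "'a::real_vector topology \<Rightarrow> bool" where
  "vector_topology T \<longleftrightarrow>
     topspace T = UNIV \<and>
     continuous_map (prod_topology T T) T (\<lambda>(x, y). x + y) \<and>
     continuous_map (prod_topology euclideanreal T) T (\<lambda>(a, x). a *\<^sub>R x)"

definition frechet_space :: "'a::real_vector topology \<Rightarrow> bool" where
  "frechet_space T \<longleftrightarrow>
     vector_topology T \<and> neighbourhood_base_of convex T \<and> completely_metrizable_space T"

text \<open>
  The weakest topology making all \<open>p n\<close> continuous is taken among vector space topologies: among
  arbitrary topologies it would consist of symmetric sets only.
\<close>

definition frechet_norm_system ::
    "'a::real_vector topology \<Rightarrow> (nat \<Rightarrow> 'a \<Rightarrow> real) \<Rightarrow> bool" where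
  "frechet_norm_system T p \<longleftrightarrow>
     (\<forall>n. is_norm (p n)) \<and>
     (\<forall>n. continuous_map T euclideanreal (p n)) \<and>
     (\<forall>T'. vector_topology T' \<and> (\<forall>n. continuous_map T' euclideanreal (p n)) \<longrightarrow>
        (\<forall>U. openin T U \<longrightarrow> openin T' U)) \<and>
     mcomplete_of (frechet_metric p)"

text \<open>
  The type of metrics is only meaningful on genuine metrics; the following facts show that the
  two metrics above are as intended.
\<close>

lemma is_norm_nonneg:
  assumes "is_norm q"
  shows "0 \<le> q x"
proof -
  have "q 0 \<le> q x + q (- x)"
    using assms unfolding is_norm_def by (metis add.right_inverse)
  moreover have "q (- x) = q x"
    using assms unfolding is_norm_def by (metis abs_minus_cancel abs_one mult_1 scaleR_minus1_left)
  moreover have "q 0 = 0"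
    using assms unfolding is_norm_def by blast
  ultimately show ?thesis by linarith
qed

lemma is_norm_minus_commute:
  assumes "is_norm q"
  shows "q (x - y) = q (y - x)"
  using assms unfolding is_norm_def
  by (metis abs_minus_cancel abs_one minus_diff_eq mult_1 scaleR_minus1_left)

lemma is_norm_triangle:
  assumes "is_norm q"
  shows "q (x - z) \<le> q (x - y) + q (y - z)"
proof -
  have "q ((x - y) + (y - z)) \<le> q (x - y) + q (y - z)"
    using assms unfolding is_norm_def by blast
  then show ?thesis by simp
qed

lemma Metric_space_norm:
  assumes "is_norm q"
  shows "Metric_space UNIV (\<lambda>x y. q (x - y))"
proof
  show "q (x - y) = 0 \<longleftrightarrow> x = y" for x y
    using assms unfolding is_norm_def by auto
qed (use assms in \<open>auto simp: is_norm_nonneg is_norm_triangle intro: is_norm_minus_commute\<close>)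

lemma mdist_norm_metric:
  assumes "is_norm q"
  shows "mdist (norm_metric q) = (\<lambda>x y. q (x - y))"
  using Metric_space.mdist_metric[OF Metric_space_norm[OF assms]] by (simp add: norm_metric_def)

lemma frechet_summable:
  assumes "\<And>n. is_norm (p n)"
  shows "summable (\<lambda>n. (1 / 2) ^ n * (p n x / (1 + p n x)))"
proof (rule summable_comparison_test)
  have "norm ((1 / 2) ^ n * (p n x / (1 + p n x))) \<le> (1 / 2) ^ n" for n
  proof -
    have "0 \<le> p n x" using is_norm_nonneg[OF assms] .
    then have "0 \<le> p n x / (1 + p n x)" "p n x / (1 + p n x) \<le> 1" by auto
    then show ?thesis
      using mult_left_le[of "p n x / (1 + p n x)" "(1 / 2) ^ n"] \<open>0 \<le> p n x\<close>
      by simp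
  qed
  then show "\<exists>N. \<forall>n\<ge>N. norm ((1 / 2) ^ n * (p n x / (1 + p n x))) \<le> (1 / 2 :: real) ^ n"
    by blast
qed (simp add: summable_geometric)

lemma Metric_space_frechet:
  assumes "\<And>n. is_norm (p n)"
  shows "Metric_space UNIV (frechet_dist p)"
proof
  have nonneg: "0 \<le> (1 / 2 :: real) ^ n * (p n x / (1 + p n x))" for n x
    using is_norm_nonneg[OF assms, of n x] by simp
  show "0 \<le> frechet_dist p x y" for x y
    unfolding frechet_dist_def by (intro suminf_nonneg frechet_summable assms nonneg)
  show "frechet_dist p x y = frechet_dist p y x" for x y
    unfolding frechet_dist_def by (simp add: is_norm_minus_commute[OF assms, of _ x y])
  show "frechet_dist p x y = 0 \<longleftrightarrow> x = y" for x y
  proof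
    assume "frechet_dist p x y = 0"
    then have "(1 / 2 :: real) ^ 0 * (p 0 (x - y) / (1 + p 0 (x - y))) = 0"
      unfolding frechet_dist_def
      using suminf_eq_zero_iff[OF frechet_summable[OF assms] nonneg] by blast
    then have "p 0 (x - y) = 0"
      using is_norm_nonneg[OF assms, of 0 "x - y"] by auto
    then show "x = y" using assms[of 0] unfolding is_norm_def by auto
  next
    assume "x = y"
    moreover have "p n 0 = 0" for n using assms[of n] unfolding is_norm_def by blast
    ultimately show "frechet_dist p x y = 0" unfolding frechet_dist_def by simp
  qed
  show "frechet_dist p x z \<le> frechet_dist p x y + frechet_dist p y z" for x y z
  proof -
    have *: "c / (1 + c) \<le> a / (1 + a) + b / (1 + b)"
      if "0 \<le> a" "0 \<le> b" "0 \<le> c" "c \<le> a + b" for a b c :: real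
    proof -
      have "c / (1 + c) \<le> (a + b) / (1 + (a + b))"
        using that by (simp add: divide_simps) (simp add: algebra_simps)
      also have "\<dots> = a / (1 + (a + b)) + b / (1 + (a + b))"
        by (simp add: add_divide_distrib)
      also have "\<dots> \<le> a / (1 + a) + b / (1 + b)"
        using that by (intro add_mono divide_left_mono) auto
      finally show ?thesis .
    qed
    have "(1 / 2 :: real) ^ n * (p n (x - z) / (1 + p n (x - z))) \<le>
        (1 / 2) ^ n * (p n (x - y) / (1 + p n (x - y))) +
        (1 / 2) ^ n * (p n (y - z) / (1 + p n (y - z)))" for n
      unfolding distrib_left[symmetric]
      by (intro mult_left_mono * is_norm_nonneg[OF assms] is_norm_triangle[OF assms]) simp
    then have "frechet_dist p x z \<le> (\<Sum>n. (1 / 2) ^ n * (p n (x - y) / (1 + p n (x - y))) +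
        (1 / 2) ^ n * (p n (y - z) / (1 + p n (y - z))))"
      unfolding frechet_dist_def by (intro suminf_le summable_add frechet_summable assms)
    also have "\<dots> = frechet_dist p x y + frechet_dist p y z"
      unfolding frechet_dist_def
      by (rule suminf_add[symmetric]) (rule frechet_summable[of p, OF assms])+
    finally show ?thesis .
  qed
qed

lemma mdist_frechet_metric:
  assumes "\<And>n. is_norm (p n)"
  shows "mdist (frechet_metric p) = frechet_dist p"
  using Metric_space.mdist_metric[OF Metric_space_frechet[OF assms]]
  by (simp add: frechet_metric_def)


section \<open>Polynomials and analytic maps\<close>

text \<open>Elements of the \<open>n\<close>-fold product of \<open>'a\<close> are the lists of length \<open>n\<close>.\<close>

definition n_linear :: "nat \<Rightarrow> ('a::real_vector list \<Rightarrow> 'b::real_vector) \<Rightarrow> bool" where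
  "n_linear n B \<longleftrightarrow> (\<forall>xs i. length xs = n \<and> i < n \<longrightarrow> linear (\<lambda>x. B (xs[i := x])))"

definition homogeneous_polynomial :: "nat \<Rightarrow> ('a::real_vector \<Rightarrow> 'b::real_vector) \<Rightarrow> bool" where
  "homogeneous_polynomial n F \<longleftrightarrow> (\<exists>B. n_linear n B \<and> (\<forall>x. F x = B (replicate n x)))"

definition power_series_at ::
    "'a::real_vector topology \<Rightarrow> ('a \<Rightarrow> 'b::real_normed_vector) \<Rightarrow> 'a \<Rightarrow> (nat \<Rightarrow> 'a \<Rightarrow> 'b) \<Rightarrow> bool" where
  "power_series_at T F x P \<longleftrightarrow>
     (\<forall>n. homogeneous_polynomial n (P n) \<and> continuous_map T euclidean (P n)) \<and>
     (\<exists>U V. openin T U \<and> 0 \<in> U \<and> U \<subseteq> V \<and>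
        uniform_limit V (\<lambda>N h. \<Sum>n<N. P n h) (\<lambda>h. F (x + h)) sequentially)"

definition analytic_map ::
    "'a::real_vector topology \<Rightarrow> ('a \<Rightarrow> 'b::real_normed_vector) \<Rightarrow> bool" where
  "analytic_map T F \<longleftrightarrow> (\<forall>x. \<exists>P. power_series_at T F x P)"

definition convergence_radius ::
    "('a::real_vector \<Rightarrow> real) \<Rightarrow> (nat \<Rightarrow> 'a \<Rightarrow> 'b::real_normed_vector) \<Rightarrow> ereal" where
  "convergence_radius q P =
     Sup {ereal r | r. 0 < r \<and> uniformly_convergent_on {h. q h \<le> r} (\<lambda>N h. \<Sum>n<N. P n h)}"

text \<open>The function \<open>Q\<close> lives on the normed space given by the type \<open>'a\<close> with the norm \<open>q\<close>.\<close>

definition uniformly_analytic_separating ::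
    "('a::real_vector \<Rightarrow> real) \<Rightarrow> ('a \<Rightarrow> real) \<Rightarrow> bool" where
  "uniformly_analytic_separating q Q \<longleftrightarrow>
     analytic_map (mtopology_of (norm_metric q)) Q \<and>
     (\<exists>R>0. \<forall>x. \<exists>P. power_series_at (mtopology_of (norm_metric q)) Q x P \<and>
        ereal R \<le> convergence_radius q P) \<and>
     (\<exists>\<alpha>. {x. Q x < \<alpha>} \<noteq> {} \<and> {x. Q x < \<alpha>} \<subseteq> {x. q x < 1})"

end

theory Submission
  imports Defs "HOL-Combinatorics.Multiset_Permutations" "HOL-Complex_Analysis.Cauchy_Integral_Formula"
begin

text \<open>
  The problem reduces to a single norm. If \<open>f\<close> is uniformly continuous for \<open>q = p k\<close>, it is enough to
  approximate \<open>f\<close> by maps that are analytic on the normed space with norm \<open>q\<close>, because the topology of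
  \<open>X\<close> is finer than that of \<open>q\<close> (\<open>norm_topology_coarser\<close>, \<open>majorized_imp_analytic_map\<close>).

  Analyticity is controlled by majorants instead of complex extensions. A map is majorized by \<open>M\<close> at \<open>x\<close> with radius \<open>r\<close> if it is
  near \<open>x\<close> the sum of a series of bounded multilinear forms whose norms \<open>b n\<close> satisfy
  \<open>(\<Sum>n. b n * r ^ n) \<le> M\<close>. For fixed \<open>x\<close> and \<open>r\<close> this behaves like a Banach algebra norm, so
  products, exponentials, inverses and absolutely convergent series of analytic maps are estimated
  without Cauchy's formula. Polarization and the identity theorem show that a uniformly analytic
  function \<open>Q\<close> is majorized at every point with one common radius (\<open>uniformly_analytic_majorized\<close>).

  Let \<open>Q a < \<alpha>\<close>, let \<open>c j\<close> be a \<open>q\<close>-dense sequence and put \<open>Q\<^sub>j x = Q (a + l *\<^sub>R (x - c j))\<close> with a large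
  \<open>l\<close>. The sets where \<open>Q\<^sub>j\<close> is below a level slightly larger than \<open>Q a\<close> cover the space, and where
  \<open>Q\<^sub>j x < \<alpha>\<close> the value \<open>f x\<close> is close to \<open>f (c j)\<close>. With weights \<open>\<kappa>\<close> that decrease fast enough, the
  increments of \<open>x \<mapsto> (sqrt (\<kappa> j) * Q\<^sub>j x)\<^sub>j\<close> have square summable majorants with small sum
  (\<open>square_summing_weights\<close>), so that this map behaves like an analytic map into \<open>\<ell>\<^sup>2\<close>; this needs the common radius, since the weights must serve every point
  at once. In these coordinates Gaussians centred at points \<open>\<xi> i\<close> of lattices in the first \<open>N i + 1\<close>
  coordinates are used as bumps, with squared distance
  \<open>D i x = (\<Sum>j\<le>N i. \<kappa> j * (Q\<^sub>j x - \<xi> i j)\<^sup>2)\<close>. The lattice points of level \<open>n\<close> are those with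
  coordinate \<open>n\<close> below a threshold and all earlier coordinates above it. Hence a point stays away
  from all lattice points of high level, and only finitely many of the others are near it
  (\<open>lattice_cover\<close>).

  The approximation is the quotient of \<open>\<Sum>i. g i x *\<^sub>R f (c (N i))\<close> by \<open>\<Sum>i. g i x\<close>, where
  \<open>g i x = exp (C i * (4 * \<rho> i - D i x))\<close> (\<open>analytic_blending\<close>). If \<open>C i\<close> grows fast enough, both series
  are locally majorized, and at every \<open>x\<close> the terms with \<open>D i x > 16 * \<rho> i\<close> are negligible against a
  single term with \<open>D i x \<le> \<rho> i\<close>, even though \<open>f\<close> may be unbounded.
\<close>

section \<open>Majorized power series\<close>

definition bounded_form ::
    "('a::real_vector \<Rightarrow> real) \<Rightarrow> nat \<Rightarrow> ('a list \<Rightarrow> 'b::real_normed_vector) \<Rightarrow> real \<Rightarrow> bool" where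
  "bounded_form q n B b \<longleftrightarrow> n_linear n B \<and> 0 \<le> b \<and>
     (\<forall>xs. length xs = n \<longrightarrow> norm (B xs) \<le> b * prod_list (map q xs))"

text \<open>
  The forms \<open>B n\<close> are bounded as multilinear maps, not only on the diagonal: then a pointwise limit of
  such forms is again multilinear, which is what makes infinite sums of analytic maps analytic.
\<close>

definition majorized ::
    "('a::real_vector \<Rightarrow> real) \<Rightarrow> 'a \<Rightarrow> real \<Rightarrow> ('a \<Rightarrow> 'b::real_normed_vector) \<Rightarrow> real \<Rightarrow> bool" where
  "majorized q x r F M \<longleftrightarrow>
     (\<exists>B b. (\<forall>n. bounded_form q n (B n) (b n)) \<and> summable (\<lambda>n. b n * r ^ n) \<and>
        (\<Sum>n. b n * r ^ n) \<le> M \<and>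
        (\<forall>h. q h \<le> r \<longrightarrow> (\<lambda>n. B n (replicate n h)) sums F (x + h)))"

lemma is_norm_zero: "is_norm q \<Longrightarrow> q 0 = 0"
  by (auto simp: is_norm_def)

lemma is_norm_scale: "is_norm q \<Longrightarrow> q (a *\<^sub>R x) = \<bar>a\<bar> * q x"
  by (auto simp: is_norm_def)

lemma is_norm_add: "is_norm q \<Longrightarrow> q (x + y) \<le> q x + q y"
  by (auto simp: is_norm_def)

lemma prod_list_norms_nonneg: "is_norm q \<Longrightarrow> 0 \<le> prod_list (map q xs)"
  by (induction xs) (auto simp: is_norm_nonneg)

lemma bounded_form_nonneg: "bounded_form q n B b \<Longrightarrow> 0 \<le> b"
  by (simp add: bounded_form_def)

lemma bounded_form_le:
  "bounded_form q n B b \<Longrightarrow> length xs = n \<Longrightarrow> norm (B xs) \<le> b * prod_list (map q xs)"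
  by (simp add: bounded_form_def)

lemma prod_list_map_replicate: "prod_list (map q (replicate n h)) = (q h :: real) ^ n"
  by (induction n) auto

lemma bounded_form_diag_le:
  assumes "is_norm q" "bounded_form q n B b" "q h \<le> r"
  shows "norm (B (replicate n h)) \<le> b * r ^ n"
proof -
  have "norm (B (replicate n h)) \<le> b * q h ^ n"
    using bounded_form_le[OF assms(2), of "replicate n h"] prod_list_map_replicate[of q n h] by simp
  also have "\<dots> \<le> b * r ^ n"
    by (intro mult_left_mono power_mono assms is_norm_nonneg[OF assms(1)]
        bounded_form_nonneg[OF assms(2)])
  finally show ?thesis .
qed

lemma n_linearD: "n_linear n B \<Longrightarrow> length xs = n \<Longrightarrow> i < n \<Longrightarrow> linear (\<lambda>x. B (xs[i := x]))"
  by (simp add: n_linear_def)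

lemma n_linear_diag_scale:
  assumes "n_linear n B"
  shows "B (replicate n (t *\<^sub>R h)) = t ^ n *\<^sub>R B (replicate n h)"
proof -
  have *: "k \<le> n \<Longrightarrow> B (replicate k (t *\<^sub>R h) @ replicate (n - k) h) = t ^ k *\<^sub>R B (replicate n h)" for k
  proof (induction k)
    case 0
    then show ?case by simp
  next
    case (Suc k)
    let ?l = "replicate k (t *\<^sub>R h) @ replicate (n - k) h"
    have l: "length ?l = n" "k < n" using Suc by auto
    have e: "n - k = Suc (n - Suc k)" using Suc by simp
    have "?l[k := y] = replicate k (t *\<^sub>R h) @ y # replicate (n - Suc k) h" for y
      unfolding e by (simp add: list_update_append)
    note u = this
    have "B (?l[k := t *\<^sub>R h]) = t *\<^sub>R B (?l[k := h])"
      by (rule linear_scale[OF n_linearD[OF assms l]])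
    moreover have "?l[k := h] = ?l" unfolding u unfolding e by simp
    moreover have "replicate (Suc k) (t *\<^sub>R h) @ replicate (n - Suc k) h = ?l[k := t *\<^sub>R h]"
      unfolding u by (simp add: replicate_app_Cons_same)
    ultimately show ?case using Suc by simp
  qed
  from *[of n] show ?thesis by simp
qed

lemma n_linear_sum:
  assumes "\<And>i. i \<in> I \<Longrightarrow> n_linear n (A i)"
  shows "n_linear n (\<lambda>xs. \<Sum>i\<in>I. A i xs)"
  using assms unfolding n_linear_def by (auto intro!: linear_compose_sum)

lemma majorizedI:
  assumes "\<And>n. bounded_form q n (B n) (b n)" "summable (\<lambda>n. b n * r ^ n)"
    "(\<Sum>n. b n * r ^ n) \<le> M" "\<And>h. q h \<le> r \<Longrightarrow> (\<lambda>n. B n (replicate n h)) sums F (x + h)"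
  shows "majorized q x r F M"
  unfolding majorized_def
  by (rule exI[of _ B], rule exI[of _ b]) (use assms in blast)

lemma majorizedE:
  assumes "majorized q x r F M"
  obtains B b where "\<And>n. bounded_form q n (B n) (b n)" "summable (\<lambda>n. b n * r ^ n)"
    "(\<Sum>n. b n * r ^ n) \<le> M" "\<And>h. q h \<le> r \<Longrightarrow> (\<lambda>n. B n (replicate n h)) sums F (x + h)"
  using assms unfolding majorized_def by blast

lemma majorized_mono: "majorized q x r F M \<Longrightarrow> M \<le> N \<Longrightarrow> majorized q x r F N"
  by (erule majorizedE, rule majorizedI) (assumption | simp)+

lemma majorized_cong:
  "(\<And>h. q h \<le> r \<Longrightarrow> F (x + h) = G (x + h)) \<Longrightarrow> majorized q x r F M = majorized q x r G M"
  unfolding majorized_def by simp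

lemma majorized_nonneg:
  assumes "majorized q x r F M" "0 \<le> r"
  shows "0 \<le> M"
proof (rule majorizedE[OF assms(1)])
  fix B b
  assume B: "\<And>n. bounded_form q n (B n) (b n)" "summable (\<lambda>n. b n * r ^ n)" "(\<Sum>n. b n * r ^ n) \<le> M"
  have "0 \<le> (\<Sum>n. b n * r ^ n)"
    by (intro suminf_nonneg B(2) mult_nonneg_nonneg bounded_form_nonneg[OF B(1)]) (use assms in simp)
  then show ?thesis using B(3) by linarith
qed

lemma majorized_norm_le:
  fixes F :: "'a::real_vector \<Rightarrow> 'b::banach"
  assumes "is_norm q" "majorized q x r F M" "q h \<le> r"
  shows "norm (F (x + h)) \<le> M"
proof -
  obtain B b where B: "\<And>n. bounded_form q n (B n) (b n)" "summable (\<lambda>n. b n * r ^ n)"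
    "(\<Sum>n. b n * r ^ n) \<le> M" "(\<lambda>n. B n (replicate n h)) sums F (x + h)"
    using assms(2,3) unfolding majorized_def by auto
  have s: "summable (\<lambda>n. norm (B n (replicate n h)))"
    by (rule summable_comparison_test'[OF B(2), where N=0])
      (use bounded_form_diag_le[OF assms(1) B(1) assms(3)] in auto)
  have "norm (F (x + h)) \<le> (\<Sum>n. norm (B n (replicate n h)))"
    using summable_norm[OF s] sums_unique[OF B(4)] by simp
  also have "\<dots> \<le> (\<Sum>n. b n * r ^ n)"
    by (intro suminf_le s B(2) bounded_form_diag_le[OF assms(1) B(1) assms(3)])
  finally show ?thesis using B(3) by linarith
qed

lemma majorized_norm_centre_le:
  fixes F :: "'a::real_vector \<Rightarrow> 'b::banach"
  assumes "is_norm q" "majorized q x r F M" "0 \<le> r"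
  shows "norm (F x) \<le> M"
  using majorized_norm_le[OF assms(1,2), of 0] assms by (simp add: is_norm_zero)

text \<open>
  Without its constant term the series gains a factor \<open>s / r\<close> when the radius shrinks to \<open>s\<close>. This is
  the source of all smallness: of the increments of the coordinates, of the Neumann series for the
  inverse, and of continuity.
\<close>

lemma majorized_minus_centre:
  assumes q: "is_norm q" and F: "majorized q x r F M" and r: "0 < s" "s \<le> r"
  shows "majorized q x s (\<lambda>y. F y - F x) (s / r * M)"
proof -
  obtain B b where B: "\<And>n. bounded_form q n (B n) (b n)" "summable (\<lambda>n. b n * r ^ n)"
    "(\<Sum>n. b n * r ^ n) \<le> M" "\<And>h. q h \<le> r \<Longrightarrow> (\<lambda>n. B n (replicate n h)) sums F (x + h)"
    using F by (rule majorizedE) blast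
  have b0: "0 \<le> b n" for n by (rule bounded_form_nonneg[OF B(1)])
  define B' where "B' n = (if n = 0 then (\<lambda>_. 0) else B n)" for n
  \<comment> \<open>The degree zero term is the constant \<open>F x\<close>; dropping it leaves a factor \<open>s\<close> in every degree.\<close>
  define b' where "b' n = (if n = 0 then 0 else b n)" for n
  have le: "b' n * s ^ n \<le> s / r * (b n * r ^ n)" for n
  proof (cases n)
    case 0
    then show ?thesis using b0 r by (simp add: b'_def)
  next
    case (Suc k)
    have "s ^ Suc k \<le> s * r ^ k" using r by (auto intro: power_mono mult_left_mono)
    also have "\<dots> = s / r * r ^ Suc k" using r by simp
    finally have "s ^ n \<le> s / r * r ^ n" unfolding Suc .
    from mult_left_mono[OF this b0[of n]] show ?thesis using Suc
      by (simp add: b'_def mult_ac del: power_Suc)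
  qed
  have s: "summable (\<lambda>n. b' n * s ^ n)"
    by (rule summable_comparison_test'[OF summable_mult[OF B(2), of "s / r"], where N=0])
      (use le b0 r in \<open>auto simp: b'_def\<close>)
  have F0: "F x = B 0 []"
  proof -
    have "(\<lambda>n. B n (replicate n 0)) sums F (x + 0)"
      using B(4)[of 0] r by (simp add: is_norm_zero[OF q])
    moreover have "B n (replicate n 0) = (if n = 0 then B 0 [] else 0)" for n
      using bounded_form_diag_le[OF q B(1), of 0 0 n] by (cases "n = 0") (auto simp: is_norm_zero[OF q] power_0_left)
    ultimately have "(\<lambda>n. if n = 0 then B 0 [] else 0) sums F x" by simp
    then show ?thesis using sums_single[of 0 "\<lambda>_. B 0 []"] sums_unique2 by blast
  qed
  show ?thesis
  proof (rule majorizedI[of q B' b'])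
    show "bounded_form q n (B' n) (b' n)" for n
      using B(1) by (auto simp: B'_def b'_def bounded_form_def n_linear_def)
    show "(\<Sum>n. b' n * s ^ n) \<le> s / r * M"
    proof -
      have "(\<Sum>n. b' n * s ^ n) \<le> (\<Sum>n. s / r * (b n * r ^ n))"
        by (intro suminf_le le s summable_mult B)
      also have "\<dots> = s / r * (\<Sum>n. b n * r ^ n)" by (rule suminf_mult[OF B(2)])
      also have "\<dots> \<le> s / r * M" using B(3) r by (intro mult_left_mono) auto
      finally show ?thesis .
    qed
    show "(\<lambda>n. B' n (replicate n h)) sums (F (x + h) - F x)" if "q h \<le> s" for h
    proof -
      have "(\<lambda>n. B n (replicate n h)) sums F (x + h)" using that r B(4) by simp
      from sums_diff[OF this sums_single[of 0 "\<lambda>_. B 0 []"]]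
      show ?thesis unfolding F0
        by (rule sums_cong[THEN iffD1, rotated]) (auto simp: B'_def)
    qed
  qed (fact s)
qed

lemma majorized_shrink:
  assumes "is_norm q" "majorized q x r F M" "0 \<le> s" "s \<le> r"
  shows "majorized q x s F M"
proof -
  obtain B b where B: "\<And>n. bounded_form q n (B n) (b n)" "summable (\<lambda>n. b n * r ^ n)"
    "(\<Sum>n. b n * r ^ n) \<le> M" "\<And>h. q h \<le> r \<Longrightarrow> (\<lambda>n. B n (replicate n h)) sums F (x + h)"
    using assms(2) by (rule majorizedE) blast
  have le: "b n * s ^ n \<le> b n * r ^ n" for n
    by (intro mult_left_mono power_mono assms bounded_form_nonneg[OF B(1)])
  have s: "summable (\<lambda>n. b n * s ^ n)"
    by (rule summable_comparison_test'[OF B(2), where N=0])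
      (use le bounded_form_nonneg[OF B(1)] assms in auto)
  show ?thesis
    by (rule majorizedI[OF B(1) s])
      (use suminf_le[OF le s B(2)] B(3,4) assms in auto)
qed

lemma majorized_const:
  assumes "is_norm q" shows "majorized q x r (\<lambda>_. c) (norm c)"
proof (rule majorizedI[of q "\<lambda>n _. if n = 0 then c else 0" "\<lambda>n. if n = 0 then norm c else 0"])
  have e: "(\<lambda>n. (if n = 0 then norm c else 0) * r ^ n) = (\<lambda>n. if n = 0 then norm c else 0)"
    by auto
  have "(\<lambda>n. if n = 0 then norm c else 0) sums norm c"
    using sums_single[of 0 "\<lambda>_. norm c"] by simp
  then show "summable (\<lambda>n. (if n = 0 then norm c else 0) * r ^ n)"
    "(\<Sum>n. (if n = 0 then norm c else 0) * r ^ n) \<le> norm c"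
    unfolding e by (auto simp: sums_iff)
  show "(\<lambda>n. if n = 0 then c else 0) sums c"
    using sums_single[of 0 "\<lambda>_. c"] by simp
qed (auto simp: bounded_form_def n_linear_def linear_zero)

lemma majorized_linear:
  assumes "majorized q x r F M" "bounded_linear L" "0 \<le> r" "\<And>z. norm (L z) \<le> K * norm z" "0 \<le> K"
  shows "majorized q x r (\<lambda>y. L (F y)) (K * M)"
proof -
  obtain B b where B: "\<And>n. bounded_form q n (B n) (b n)" "summable (\<lambda>n. b n * r ^ n)"
    "(\<Sum>n. b n * r ^ n) \<le> M" "\<And>h. q h \<le> r \<Longrightarrow> (\<lambda>n. B n (replicate n h)) sums F (x + h)"
    using assms(1) by (rule majorizedE) blast
  have e: "(\<lambda>n. K * b n * r ^ n) = (\<lambda>n. K * (b n * r ^ n))" by (simp add: ac_simps)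
  show ?thesis
  proof (rule majorizedI[of q "\<lambda>n xs. L (B n xs)" "\<lambda>n. K * b n"])
    show "bounded_form q n (\<lambda>xs. L (B n xs)) (K * b n)" for n
    proof -
      have "norm (L (B n xs)) \<le> K * b n * prod_list (map q xs)" if "length xs = n" for xs
        using assms(4)[of "B n xs"] mult_left_mono[OF bounded_form_le[OF B(1) that] assms(5)]
        by (simp add: mult.assoc)
      moreover have "n_linear n (\<lambda>xs. L (B n xs))"
        using B(1)[of n] bounded_linear.linear[OF assms(2)]
        unfolding bounded_form_def n_linear_def
        by (auto intro: linear_compose[unfolded o_def])
      ultimately show ?thesis using bounded_form_nonneg[OF B(1)] assms(5)
        by (simp add: bounded_form_def)
    qed
    show "(\<Sum>n. K * b n * r ^ n) \<le> K * M" unfolding e suminf_mult[OF B(2)]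
      using B(3) assms(5) by (intro mult_left_mono) auto
  qed (use B(4) summable_mult[OF B(2)] bounded_linear.sums[OF assms(2)] in \<open>auto simp: e\<close>)
qed

lemma majorized_add:
  assumes F: "majorized q x r F M" and G: "majorized q x r G N" and q: "is_norm q"
  shows "majorized q x r (\<lambda>y. F y + G y) (M + N)"
proof -
  obtain B b where B: "\<And>n. bounded_form q n (B n) (b n)" "summable (\<lambda>n. b n * r ^ n)"
    "(\<Sum>n. b n * r ^ n) \<le> M" "\<And>h. q h \<le> r \<Longrightarrow> (\<lambda>n. B n (replicate n h)) sums F (x + h)"
    using F by (rule majorizedE) blast
  obtain C c where C: "\<And>n. bounded_form q n (C n) (c n)" "summable (\<lambda>n. c n * r ^ n)"
    "(\<Sum>n. c n * r ^ n) \<le> N" "\<And>h. q h \<le> r \<Longrightarrow> (\<lambda>n. C n (replicate n h)) sums G (x + h)"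
    using G by (rule majorizedE) blast
  have e: "(\<lambda>n. (b n + c n) * r ^ n) = (\<lambda>n. b n * r ^ n + c n * r ^ n)"
    by (simp add: distrib_right)
  show ?thesis
  proof (rule majorizedI[of q "\<lambda>n xs. B n xs + C n xs" "\<lambda>n. b n + c n"])
    show "bounded_form q n (\<lambda>xs. B n xs + C n xs) (b n + c n)" for n
    proof -
      have "norm (B n xs + C n xs) \<le> (b n + c n) * prod_list (map q xs)" if "length xs = n" for xs
        using norm_triangle_ineq[of "B n xs" "C n xs"] bounded_form_le[OF B(1) that]
          bounded_form_le[OF C(1) that] by (simp add: distrib_right)
      then show ?thesis using B(1)[of n] C(1)[of n]
        unfolding bounded_form_def n_linear_def by (auto intro: linear_compose_add)
    qed
    show "(\<Sum>n. (b n + c n) * r ^ n) \<le> M + N" unfolding e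
      using suminf_add[OF B(2) C(2)] B(3) C(3) by simp
  qed (use B C in \<open>auto simp: e intro!: summable_add sums_add\<close>)
qed

lemma majorized_sum:
  assumes "is_norm q" "finite I" "\<And>i. i \<in> I \<Longrightarrow> majorized q x r (F i) (M i)"
  shows "majorized q x r (\<lambda>y. \<Sum>i\<in>I. F i y) (\<Sum>i\<in>I. M i)"
  using assms(2,3)
proof (induction I)
  case empty
  then show ?case using majorized_const[OF assms(1), of x r 0] by simp
next
  case (insert i I)
  then show ?case by (simp add: majorized_add assms(1))
qed

text \<open>
  Both the bounds and the forms are summed over \<open>i\<close> degree by degree; the interchange of the sums over
  \<open>i\<close> and over the degree is Tannery's theorem with the bound \<open>2 * M i\<close> for the remainders.
\<close>

lemma majorized_suminf:
  fixes F :: "nat \<Rightarrow> 'a::real_vector \<Rightarrow> 'b::banach"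
  assumes q: "is_norm q" and r: "0 < r"
    and F: "\<And>i. majorized q x r (F i) (M i)" and M: "summable M"
  shows "majorized q x r (\<lambda>y. \<Sum>i. F i y) (\<Sum>i. M i)"
proof -
  define P where "P i B b \<longleftrightarrow> (\<forall>n. bounded_form q n (B n) (b n)) \<and>
    summable (\<lambda>n. b n * r ^ n) \<and> (\<Sum>n. b n * r ^ n) \<le> M i \<and>
    (\<forall>h. q h \<le> r \<longrightarrow> (\<lambda>n. B n (replicate n h)) sums F i (x + h))" for i B b
  have "\<exists>B b. P i B b" for i
    using F[of i] unfolding majorized_def P_def .
  then obtain B b where "\<And>i. P i (B i) (b i)" by metis
  then have B: "\<And>i n. bounded_form q n (B i n) (b i n)"
    "\<And>i. summable (\<lambda>n. b i n * r ^ n)" "\<And>i. (\<Sum>n. b i n * r ^ n) \<le> M i"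
    "\<And>i h. q h \<le> r \<Longrightarrow> (\<lambda>n. B i n (replicate n h)) sums F i (x + h)"
    unfolding P_def by auto
  have b0: "0 \<le> b i n" for i n by (rule bounded_form_nonneg[OF B(1)])
  have bM: "b i n * r ^ n \<le> M i" for i n
    using sum_le_suminf[OF B(2), of "{n}" i] B(3)[of i] b0 r by auto
  have sb: "summable (\<lambda>i. b i n)" for n
  proof (rule summable_comparison_test'[OF summable_mult[OF M, of "1 / r ^ n"], where N=0])
    show "norm (b i n) \<le> 1 / r ^ n * M i" for i
      using bM[of i n] b0[of i n] r by (simp add: field_simps)
  qed
  have partial: "(\<Sum>n<N. \<Sum>i. b i n * r ^ n) \<le> suminf M" for N
  proof -
    have "(\<Sum>n<N. \<Sum>i. b i n * r ^ n) = (\<Sum>i. \<Sum>n<N. b i n * r ^ n)"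
      by (rule suminf_sum[symmetric]) (rule summable_mult2[OF sb])
    also have "\<dots> \<le> suminf M"
    proof (rule suminf_le[OF _ _ M])
      show "(\<Sum>n<N. b i n * r ^ n) \<le> M i" for i
        using sum_le_suminf[OF B(2), of "{..<N}" i] B(3)[of i] b0 r by auto
    qed (rule summable_sum, rule summable_mult2[OF sb])
    finally show ?thesis .
  qed
  have eq: "(\<Sum>i. b i n) * r ^ n = (\<Sum>i. b i n * r ^ n)" for n
    by (rule suminf_mult2[OF sb])
  have s: "summable (\<lambda>n. (\<Sum>i. b i n) * r ^ n)"
    unfolding eq
  proof (rule bounded_imp_summable[where B="suminf M"])
    show "0 \<le> (\<Sum>i. b i n * r ^ n)" for n
      using b0 r by (intro suminf_nonneg[OF summable_mult2[OF sb]]) auto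
    show "(\<Sum>n\<le>N. \<Sum>i. b i n * r ^ n) \<le> suminf M" for N
      using partial[of "Suc N"] by (simp add: lessThan_Suc_atMost)
  qed
  have nB: "norm (B i n xs) \<le> b i n * prod_list (map q xs)" if "length xs = n" for i n xs
    by (rule bounded_form_le[OF B(1) that])
  have sB: "summable (\<lambda>i. norm (B i n xs))" if "length xs = n" for n xs
    by (rule summable_comparison_test'[OF summable_mult2[OF sb[of n], of "prod_list (map q xs)"], where N=0])
      (use nB[OF that] in auto)
  show ?thesis
  proof (rule majorizedI[of q "\<lambda>n xs. \<Sum>i. B i n xs" "\<lambda>n. \<Sum>i. b i n"])
    show "bounded_form q n (\<lambda>xs. \<Sum>i. B i n xs) (\<Sum>i. b i n)" for n
      unfolding bounded_form_def
    proof (intro conjI allI impI)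
      show "0 \<le> (\<Sum>i. b i n)" by (rule suminf_nonneg[OF sb b0])
      show "norm (\<Sum>i. B i n xs) \<le> (\<Sum>i. b i n) * prod_list (map q xs)" if "length xs = n" for xs
      proof -
        have "norm (\<Sum>i. B i n xs) \<le> (\<Sum>i. norm (B i n xs))"
          by (rule summable_norm[OF sB[OF that]])
        also have "\<dots> \<le> (\<Sum>i. b i n * prod_list (map q xs))"
          by (rule suminf_le[OF nB[OF that] sB[OF that] summable_mult2[OF sb]])
        finally show ?thesis using suminf_mult2[OF sb] by simp
      qed
      show "n_linear n (\<lambda>xs. \<Sum>i. B i n xs)"
        unfolding n_linear_def
      proof (intro allI impI)
        fix xs :: "'a list" and k assume k: "length xs = n \<and> k < n"
        have L: "linear (\<lambda>y. B i n (xs[k := y]))" for i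
          using B(1)[of n i] k by (auto simp: bounded_form_def n_linear_def)
        have S: "summable (\<lambda>i. B i n (xs[k := y]))" for y
          using sB[of "xs[k := y]" n] k by (auto intro: summable_norm_cancel)
        show "linear (\<lambda>y. \<Sum>i. B i n (xs[k := y]))"
          by (rule linearI)
            (simp_all add: linear_add[OF L] linear_scale[OF L] suminf_add[OF S S] suminf_scaleR_right[OF S])
      qed
    qed
    show "(\<Sum>n. (\<Sum>i. b i n) * r ^ n) \<le> suminf M"
      by (rule suminf_le_const[OF s]) (use partial in \<open>simp add: eq\<close>)
    show "(\<lambda>n. \<Sum>i. B i n (replicate n h)) sums (\<Sum>i. F i (x + h))" if h: "q h \<le> r" for h
    proof -
      have SB: "summable (\<lambda>i. B i n (replicate n h))" for n
        using sB[of "replicate n h" n] by (auto intro: summable_norm_cancel)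
      define R where "R i N = F i (x + h) - (\<Sum>n<N. B i n (replicate n h))" for i N
      have Fb: "norm (F i (x + h)) \<le> M i" for i
        by (rule majorized_norm_le[OF q F h])
      have Rb: "norm (R i N) \<le> 2 * M i" for i N
      proof -
        have "norm (\<Sum>n<N. B i n (replicate n h)) \<le> (\<Sum>n<N. b i n * r ^ n)"
          by (rule order_trans[OF norm_sum sum_mono]) (rule bounded_form_diag_le[OF q B(1) h])
        also have "\<dots> \<le> M i"
          using sum_le_suminf[OF B(2), of "{..<N}" i] B(3)[of i] b0 r by auto
        finally show ?thesis
          using Fb[of i] norm_triangle_ineq4[of "F i (x + h)" "\<Sum>n<N. B i n (replicate n h)"]
          by (simp add: R_def)
      qed
      have sR: "summable (\<lambda>i. norm (R i N))" for N
        by (rule summable_comparison_test'[OF summable_mult[OF M, of 2], where N=0]) (use Rb in auto)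
      have sF: "summable (\<lambda>i. F i (x + h))"
        by (rule summable_comparison_test'[OF M, where N=0]) (use Fb in auto)
      have lim: "(\<lambda>N. norm (R i N)) \<longlonglongrightarrow> 0" for i
      proof -
        have "(\<lambda>N. F i (x + h) - (\<Sum>n<N. B i n (replicate n h))) \<longlonglongrightarrow> F i (x + h) - F i (x + h)"
          by (intro tendsto_diff tendsto_const) (use B(4)[OF h, of i] in \<open>simp add: sums_def\<close>)
        then show ?thesis by (simp add: R_def tendsto_norm_zero)
      qed
      have "(\<lambda>N. \<Sum>i. norm (R i N)) \<longlonglongrightarrow> (\<Sum>i::nat. 0)"
        by (rule tannerys_theorem[where a = "\<lambda>i N. norm (R i N)" and M = "\<lambda>i. 2 * M i"
              and F = sequentially and b = "\<lambda>_. 0", THEN conjunct2, THEN conjunct2])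
          (use lim Rb summable_mult[OF M, of 2] in \<open>auto intro!: always_eventually\<close>)
      then have T: "(\<lambda>N. \<Sum>i. norm (R i N)) \<longlonglongrightarrow> 0" by simp
      have "(\<lambda>N. (\<Sum>i. F i (x + h)) - (\<Sum>n<N. \<Sum>i. B i n (replicate n h))) \<longlonglongrightarrow> 0"
      proof (rule Lim_null_comparison[OF _ T], rule always_eventually, rule allI)
        fix N
        have "(\<Sum>i. F i (x + h)) - (\<Sum>n<N. \<Sum>i. B i n (replicate n h)) = (\<Sum>i. R i N)"
          unfolding R_def
          by (subst suminf_diff[OF sF summable_sum[OF SB], symmetric]) (simp only: suminf_sum[OF SB])
        then show "norm ((\<Sum>i. F i (x + h)) - (\<Sum>n<N. \<Sum>i. B i n (replicate n h))) \<le> (\<Sum>i. norm (R i N))"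
          using summable_norm[OF sR] by simp
      qed
      then have "(\<lambda>N. (\<Sum>i. F i (x + h)) - ((\<Sum>i. F i (x + h)) -
          (\<Sum>n<N. \<Sum>i. B i n (replicate n h)))) \<longlonglongrightarrow> (\<Sum>i. F i (x + h)) - 0"
        by (intro tendsto_diff tendsto_const)
      then show ?thesis by (simp add: sums_def)
    qed
  qed (fact s)
qed

text \<open>
  The tensor products of the forms are the summands of the Cauchy product; the forms are not made
  symmetric, so that the bounds multiply exactly.
\<close>

lemma majorized_mult:
  fixes F G :: "'a::real_vector \<Rightarrow> real"
  assumes F: "majorized q x r F M" and G: "majorized q x r G N" and q: "is_norm q" and r: "0 \<le> r"
  shows "majorized q x r (\<lambda>y. F y * G y) (M * N)"
proof -
  obtain B b where B: "\<And>n. bounded_form q n (B n) (b n)" "summable (\<lambda>n. b n * r ^ n)"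
    "(\<Sum>n. b n * r ^ n) \<le> M" "\<And>h. q h \<le> r \<Longrightarrow> (\<lambda>n. B n (replicate n h)) sums F (x + h)"
    using F by (rule majorizedE) blast
  obtain C c where C: "\<And>n. bounded_form q n (C n) (c n)" "summable (\<lambda>n. c n * r ^ n)"
    "(\<Sum>n. c n * r ^ n) \<le> N" "\<And>h. q h \<le> r \<Longrightarrow> (\<lambda>n. C n (replicate n h)) sums G (x + h)"
    using G by (rule majorizedE) blast
  note b0 = bounded_form_nonneg[OF B(1)] and c0 = bounded_form_nonneg[OF C(1)]
  define A where "A n xs = (\<Sum>i\<le>n. B i (take i xs) * C (n - i) (drop i xs))" for n xs
  define a where "a n = (\<Sum>i\<le>n. b i * c (n - i))" for n
  have sn: "summable (\<lambda>n. norm (b n * r ^ n))" "summable (\<lambda>n. norm (c n * r ^ n))"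
    using B(2) C(2) b0 c0 r by simp_all
  have eq: "a n * r ^ n = (\<Sum>i\<le>n. (b i * r ^ i) * (c (n - i) * r ^ (n - i)))" for n
    unfolding a_def sum_distrib_right
  proof (rule sum.cong)
    fix i assume "i \<in> {..n}"
    then have "r ^ n = r ^ i * r ^ (n - i)" by (simp flip: power_add)
    then show "b i * c (n - i) * r ^ n = b i * r ^ i * (c (n - i) * r ^ (n - i))" by simp
  qed simp
  have S: "(\<lambda>n. a n * r ^ n) sums ((\<Sum>n. b n * r ^ n) * (\<Sum>n. c n * r ^ n))"
    unfolding eq by (rule Cauchy_product_sums[OF sn])
  show ?thesis
  proof (rule majorizedI[of q A a])
    show "bounded_form q n (A n) (a n)" for n
      unfolding bounded_form_def
    proof (intro conjI allI impI)
      show "0 \<le> a n" by (auto simp: a_def intro!: sum_nonneg mult_nonneg_nonneg b0 c0)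
      show "norm (A n xs) \<le> a n * prod_list (map q xs)" if "length xs = n" for xs
        unfolding A_def a_def sum_distrib_right
      proof (rule order_trans[OF norm_sum sum_mono])
        fix i assume "i \<in> {..n}"
        then have l: "length (take i xs) = i" "length (drop i xs) = n - i" using that by auto
        have "norm (B i (take i xs) * C (n - i) (drop i xs)) \<le>
            (b i * prod_list (map q (take i xs))) * (c (n - i) * prod_list (map q (drop i xs)))"
          unfolding norm_mult
          by (intro mult_mono bounded_form_le[OF B(1) l(1)] bounded_form_le[OF C(1) l(2)]
              mult_nonneg_nonneg b0 prod_list_norms_nonneg q norm_ge_zero)
        also have "\<dots> = b i * c (n - i) * prod_list (map q (take i xs @ drop i xs))"
          unfolding map_append prod_list.append by simp
        finally show "norm (B i (take i xs) * C (n - i) (drop i xs)) \<le>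
            b i * c (n - i) * prod_list (map q xs)" by simp
      qed
      show "n_linear n (A n)"
        unfolding A_def
      proof (rule n_linear_sum)
        fix i assume i: "i \<in> {..n}"
        show "n_linear n (\<lambda>xs. B i (take i xs) * C (n - i) (drop i xs))"
          unfolding n_linear_def
        proof (intro allI impI)
          fix xs :: "'a list" and j assume j: "length xs = n \<and> j < n"
          show "linear (\<lambda>y. B i (take i (xs[j := y])) * C (n - i) (drop i (xs[j := y])))"
          proof (cases "j < i")
            case True
            have "linear (\<lambda>y. B i ((take i xs)[j := y]))"
              using B(1)[of i] True i j by (auto simp: bounded_form_def n_linear_def)
            then show ?thesis using True
              by (simp add: take_update_swap linear_iff algebra_simps)
          next
            case False
            have "linear (\<lambda>y. C (n - i) ((drop i xs)[j - i := y]))"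
              using C(1)[of "n - i"] False i j by (auto simp: bounded_form_def n_linear_def)
            then show ?thesis using False
              by (simp add: drop_update_swap linear_iff algebra_simps)
          qed
        qed
      qed
    qed
    show "summable (\<lambda>n. a n * r ^ n)" using S by (rule sums_summable)
    show "(\<Sum>n. a n * r ^ n) \<le> M * N"
      unfolding sums_unique[OF S, symmetric]
      by (intro mult_mono B C suminf_nonneg order_trans[OF _ B(3)])
        (use b0 c0 r in auto)
    show "(\<lambda>n. A n (replicate n h)) sums (F (x + h) * G (x + h))" if h: "q h \<le> r" for h
    proof -
      have "summable (\<lambda>n. norm (B n (replicate n h)))" "summable (\<lambda>n. norm (C n (replicate n h)))"
        using bounded_form_diag_le[OF q B(1) h] bounded_form_diag_le[OF q C(1) h]
        by (auto intro: summable_comparison_test'[OF B(2), where N=0]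
            summable_comparison_test'[OF C(2), where N=0])
      from Cauchy_product_sums[OF this]
      have "(\<lambda>n. \<Sum>i\<le>n. B i (replicate i h) * C (n - i) (replicate (n - i) h)) sums
          (F (x + h) * G (x + h))"
        using sums_unique[OF B(4)[OF h]] sums_unique[OF C(4)[OF h]] by simp
      moreover have "A n (replicate n h) = (\<Sum>i\<le>n. B i (replicate i h) * C (n - i) (replicate (n - i) h))" for n
        unfolding A_def by (intro sum.cong) (auto simp: min_def)
      ultimately show ?thesis by simp
    qed
  qed
qed

lemma majorized_power:
  fixes F :: "'a::real_vector \<Rightarrow> real"
  assumes "majorized q x r F M" "is_norm q" "0 \<le> r"
  shows "majorized q x r (\<lambda>y. F y ^ n) (M ^ n)"
proof (induction n)
  case 0
  then show ?case using majorized_const[OF assms(2), of x r "1::real"] by simp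
next
  case (Suc n)
  then show ?case using majorized_mult[OF assms(1) Suc assms(2,3)] by simp
qed

lemma majorized_exp:
  fixes F :: "'a::real_vector \<Rightarrow> real"
  assumes F: "majorized q x r F M" and q: "is_norm q" and r: "0 < r"
  shows "majorized q x r (\<lambda>y. exp (F y)) (exp M)"
proof -
  have t: "majorized q x r (\<lambda>y. F y ^ n /\<^sub>R fact n) (M ^ n /\<^sub>R fact n)" for n
    using majorized_linear[OF majorized_power[OF F q, of n], of "\<lambda>z. z /\<^sub>R fact n" "inverse (fact n)"] r
    using bounded_linear_scaleR_right[of "inverse (fact n)", where 'a=real] by (simp add: abs_mult)
  show ?thesis
    using majorized_suminf[OF q r t summable_exp_generic] by (simp add: exp_def)
qed

text \<open>
  The Neumann series of \<open>F y / F x = 1 - z\<close> converges as soon as \<open>z\<close> has majorant \<open>1 / 2\<close>.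
\<close>

lemma majorized_inverse:
  fixes F :: "'a::real_vector \<Rightarrow> real"
  assumes F: "majorized q x r F M" and q: "is_norm q" and r: "0 < r" and nz: "F x \<noteq> 0"
  shows "\<exists>s N. 0 < s \<and> s \<le> r \<and> majorized q x s (\<lambda>y. inverse (F y)) N"
proof -
  define c where "c = F x"
  define s where "s = min r (r * \<bar>c\<bar> / (2 * (M + 1)))"
  have M: "0 \<le> M" using majorized_nonneg[OF F] r by simp
  have s: "0 < s" "s \<le> r" using r nz M by (auto simp: s_def c_def)
  have sM: "s / r * M \<le> \<bar>c\<bar> / 2"
  proof -
    have "s * M \<le> (r * \<bar>c\<bar> / (2 * (M + 1))) * (M + 1)"
      using M r by (intro mult_mono) (auto simp: s_def)
    also have "\<dots> = r * \<bar>c\<bar> / 2" using M by (simp add: field_simps)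
    finally show ?thesis using r by (simp add: field_simps)
  qed
  have "majorized q x s (\<lambda>y. F y - F x) (\<bar>c\<bar> / 2)"
    by (rule majorized_mono[OF majorized_minus_centre[OF q F s] sM])
  from majorized_linear[OF this bounded_linear_mult_right[of "- 1 / c"], of "1 / \<bar>c\<bar>"]
  have e: "majorized q x s (\<lambda>y. (- 1 / c) * (F y - c)) (1 / 2)"
    using s nz by (simp add: abs_mult c_def)
  have "summable (\<lambda>n. (1 / 2 :: real) ^ n)" by (rule summable_geometric) simp
  note sum = majorized_suminf[OF q s(1) majorized_power[OF e q less_imp_le[OF s(1)]] this]
  have val: "(\<Sum>n. ((- 1 / c) * (F y - c)) ^ n) = c * inverse (F y)" if y: "y = x + h" "q h \<le> s" for y h
  proof -
    let ?z = "(- 1 / c) * (F y - c)"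
    have "norm ?z \<le> 1 / 2" using majorized_norm_le[OF q e y(2)] y by simp
    then have "norm ?z < 1" by linarith
    then have "(\<Sum>n. ?z ^ n) = 1 / (1 - ?z)" by (rule suminf_geometric)
    also have "1 - ?z = F y / c" using nz by (simp add: c_def field_simps)
    finally show ?thesis by (simp add: field_simps)
  qed
  have "majorized q x s (\<lambda>y. c * inverse (F y)) (\<Sum>n. (1 / 2) ^ n)"
    using sum by (rule majorized_cong[THEN iffD1, rotated]) (use val in blast)
  from majorized_linear[OF this bounded_linear_mult_right[of "1 / c"], of "1 / \<bar>c\<bar>"]
  have "majorized q x s (\<lambda>y. inverse (F y)) (1 / \<bar>c\<bar> * (\<Sum>n. (1 / 2) ^ n))"
    using s nz by (simp add: abs_mult c_def)
  then show ?thesis using s by blast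
qed

section \<open>Changing the centre\<close>

lemma n_linear_insert:
  assumes B: "n_linear (Suc n) B" and m: "m \<le> n"
  shows "n_linear n (\<lambda>xs. B (take m xs @ a # drop m xs))"
  unfolding n_linear_def
proof (intro allI impI)
  fix xs :: "'a list" and i assume i: "length xs = n \<and> i < n"
  let ?l = "take m xs @ a # drop m xs"
  have l: "length ?l = Suc n" using i m by simp
  show "linear (\<lambda>y. B (take m (xs[i := y]) @ a # drop m (xs[i := y])))"
  proof (cases "i < m")
    case True
    then have "take m (xs[i := y]) @ a # drop m (xs[i := y]) = ?l[i := y]" for y
      using i m by (simp add: list_update_append take_update_swap)
    then show ?thesis using n_linearD[OF B l, of i] i by simp
  next
    case False
    then have "take m (xs[i := y]) @ a # drop m (xs[i := y]) = ?l[Suc i := y]" for y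
      using i m by (simp add: list_update_append drop_update_swap Suc_diff_le)
    then show ?thesis using n_linearD[OF B l, of "Suc i"] i by simp
  qed
qed

lemma bounded_form_insert:
  assumes q: "is_norm q" and B: "bounded_form q (Suc n) B b" and m: "m \<le> n"
  shows "bounded_form q n (\<lambda>xs. B (take m xs @ a # drop m xs)) (b * q a)"
  unfolding bounded_form_def
proof (intro conjI allI impI)
  show "n_linear n (\<lambda>xs. B (take m xs @ a # drop m xs))"
    using B m by (simp add: bounded_form_def n_linear_insert)
  show "0 \<le> b * q a" using bounded_form_nonneg[OF B] is_norm_nonneg[OF q] by simp
  fix xs :: "'a list" assume "length xs = n"
  then have "norm (B (take m xs @ a # drop m xs)) \<le> b * prod_list (map q (take m xs @ a # drop m xs))"
    using m by (intro bounded_form_le[OF B]) simp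
  also have "prod_list (map q (take m xs @ a # drop m xs)) =
      q a * prod_list (map q (take m xs @ drop m xs))"
    unfolding map_append prod_list.append by simp
  finally show "norm (B (take m xs @ a # drop m xs)) \<le> b * q a * prod_list (map q xs)" by simp
qed

lemma majorized_monomial:
  assumes q: "is_norm q" and B: "bounded_form q k B b"
  shows "majorized q y r (\<lambda>u. B (replicate k (u - y))) (b * r ^ k)"
proof (rule majorizedI[of q "\<lambda>n xs. if n = k then B xs else 0" "\<lambda>n. if n = k then b else 0"])
  have e: "(\<lambda>n. (if n = k then b else 0) * r ^ n) = (\<lambda>n. if n = k then b * r ^ n else 0)"
    by auto
  have "(\<lambda>n. if n = k then b * r ^ n else 0) sums (b * r ^ k)"
    by (rule sums_single)
  then show "summable (\<lambda>n. (if n = k then b else 0) * r ^ n)"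
    "(\<Sum>n. (if n = k then b else 0) * r ^ n) \<le> b * r ^ k"
    unfolding e by (auto simp: sums_iff)
  show "(\<lambda>n. if n = k then B (replicate n h) else 0) sums B (replicate k (y + h - y))" for h
    using sums_single[of k "\<lambda>n. B (replicate n h)"] by simp
  show "bounded_form q n (\<lambda>xs. if n = k then B xs else 0) (if n = k then b else 0)" for n
    using B by (cases "n = k") (auto simp: bounded_form_def n_linear_def linear_zero)
qed

text \<open>
  Expanding \<open>B\<close> at \<open>a + v\<close> in the last of the \<open>m\<close> slots gives two terms: one has a form of lower degree
  with \<open>a\<close> inserted, the other one has moved a slot from the first block to the second. The second
  block exists only to make this induction on \<open>m\<close> possible.
\<close>

lemma majorized_shifted_monomial:
  fixes B :: "'a::real_vector list \<Rightarrow> 'b::real_normed_vector"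
  assumes q: "is_norm q" and B: "bounded_form q (m + k) B b"
  shows "majorized q y r (\<lambda>u. B (replicate m (a + (u - y)) @ replicate k (u - y)))
    (b * (q a + r) ^ m * r ^ k)"
  using B
proof (induction m arbitrary: B b k)
  case 0
  then show ?case using majorized_monomial[OF q, of k B b y r] by simp
next
  case (Suc m)
  have B1: "bounded_form q (m + k) (\<lambda>xs. B (take m xs @ a # drop m xs)) (b * q a)"
    by (rule bounded_form_insert[OF q]) (use Suc.prems in simp_all)
  have B2: "bounded_form q (m + Suc k) B b" using Suc.prems by simp
  have split: "B (replicate (Suc m) (a + v) @ replicate k v) =
      B (replicate m (a + v) @ a # replicate k v) + B (replicate m (a + v) @ replicate (Suc k) v)" for v
  proof -
    let ?l = "replicate m (a + v) @ v # replicate k v"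
    have u: "?l[m := z] = replicate m (a + v) @ z # replicate k v" for z
      by (simp add: list_update_append)
    have "linear (\<lambda>z. B (?l[m := z]))"
      by (rule n_linearD[of "Suc m + k"]) (use Suc.prems in \<open>auto simp: bounded_form_def\<close>)
    from linear_add[OF this, of a v] show ?thesis
      unfolding u by (simp add: replicate_app_Cons_same)
  qed
  have "majorized q y r (\<lambda>u. B (replicate m (a + (u - y)) @ a # replicate k (u - y)) +
      B (replicate m (a + (u - y)) @ replicate (Suc k) (u - y)))
      (b * q a * (q a + r) ^ m * r ^ k + b * (q a + r) ^ m * r ^ Suc k)"
    using majorized_add[OF Suc.IH[OF B1] Suc.IH[OF B2] q] by simp
  then show ?case unfolding split by (simp add: algebra_simps)
qed

text \<open>
  The binomial bound \<open>(q a + r) ^ n \<le> (s + r) ^ n\<close> shows that the shifted monomials form a majorized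
  series, which gives the expansion at \<open>y\<close> with the same majorant.
\<close>

lemma majorized_recentre:
  fixes F :: "'a::real_vector \<Rightarrow> 'b::banach"
  assumes q: "is_norm q" and F: "majorized q x (s + r) F M" and r: "0 < r" and s: "q (y - x) \<le> s"
  shows "majorized q y r F M"
proof -
  obtain B b where B: "\<And>n. bounded_form q n (B n) (b n)" "summable (\<lambda>n. b n * (s + r) ^ n)"
    "(\<Sum>n. b n * (s + r) ^ n) \<le> M" "\<And>h. q h \<le> s + r \<Longrightarrow> (\<lambda>n. B n (replicate n h)) sums F (x + h)"
    using F by (rule majorizedE) blast
  define a where "a = y - x"
  have qa: "0 \<le> q a" "q a \<le> s" using is_norm_nonneg[OF q] s by (auto simp: a_def)
  have "majorized q y r (\<lambda>u. B n (replicate n (a + (u - y)))) (b n * (s + r) ^ n)" for n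
  proof (rule majorized_mono)
    show "majorized q y r (\<lambda>u. B n (replicate n (a + (u - y)))) (b n * (q a + r) ^ n)"
      using majorized_shifted_monomial[OF q, of n 0 "B n" "b n" y r a] B(1)[of n] by simp
    show "b n * (q a + r) ^ n \<le> b n * (s + r) ^ n"
      using qa r by (intro mult_left_mono power_mono bounded_form_nonneg[OF B(1)]) auto
  qed
  from majorized_suminf[OF q r this B(2)]
  have "majorized q y r (\<lambda>u. \<Sum>n. B n (replicate n (a + (u - y)))) M"
    by (rule majorized_mono) (rule B(3))
  then show ?thesis
  proof (rule majorized_cong[THEN iffD1, rotated])
    fix h assume "q h \<le> r"
    then have "q (a + h) \<le> s + r" using is_norm_add[OF q, of a h] qa by simp
    from sums_unique[OF B(4)[OF this]]
    show "(\<Sum>n. B n (replicate n (a + (y + h - y)))) = F (y + h)"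
      by (simp add: a_def)
  qed
qed

section \<open>Polarization\<close>

lemma n_linear_expand_sum:
  assumes "finite S" "n_linear (length zs + n) B"
  shows "B (zs @ replicate n (\<Sum>j\<in>S. x j)) = (\<Sum>ws | set ws \<subseteq> S \<and> length ws = n. B (zs @ map x ws))"
  using assms(2)
proof (induction n arbitrary: zs)
  case 0
  have "{ws. set ws \<subseteq> S \<and> length ws = 0} = {[]}" by auto
  then show ?case by simp
next
  case (Suc n)
  let ?W = "\<lambda>n. {ws. set ws \<subseteq> S \<and> length ws = n}"
  let ?s = "\<Sum>j\<in>S. x j"
  let ?l = "zs @ 0 # replicate n ?s"
  have "linear (\<lambda>z. B (?l[length zs := z]))"
    by (rule n_linearD[OF Suc.prems]) auto
  then have lin: "linear (\<lambda>z. B (zs @ z # replicate n ?s))"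
    by (simp add: list_update_append)
  have img: "?W (Suc n) = (\<lambda>(j, ws). j # ws) ` (S \<times> ?W n)"
    by (auto simp: length_Suc_conv image_iff)
  have "B (zs @ replicate (Suc n) ?s) = (\<Sum>j\<in>S. B (zs @ x j # replicate n ?s))"
    using linear_sum[OF lin] by simp
  also have "\<dots> = (\<Sum>j\<in>S. \<Sum>ws\<in>?W n. B (zs @ map x (j # ws)))"
  proof (rule sum.cong)
    fix j
    show "B (zs @ x j # replicate n ?s) = (\<Sum>ws\<in>?W n. B (zs @ map x (j # ws)))"
      using Suc.IH[of "zs @ [x j]"] Suc.prems by simp
  qed simp
  also have "\<dots> = (\<Sum>(j, ws)\<in>S \<times> ?W n. B (zs @ map x (j # ws)))"
    by (rule sum.cartesian_product)
  also have "\<dots> = (\<Sum>ws\<in>?W (Suc n). B (zs @ map x ws))"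
    unfolding img by (subst sum.reindex) (auto simp: inj_on_def case_prod_unfold)
  finally show ?case .
qed

lemma n_linear_scale_all:
  assumes "n_linear n B"
  shows "B (map (\<lambda>i. t i *\<^sub>R x i) [0..<n]) = (\<Prod>i<n. t i) *\<^sub>R B (map x [0..<n])"
proof -
  have "k \<le> n \<Longrightarrow> B (map (\<lambda>i. (if i < k then t i else 1) *\<^sub>R x i) [0..<n]) =
      (\<Prod>i<k. t i) *\<^sub>R B (map x [0..<n])" for k
  proof (induction k)
    case 0
    then show ?case by simp
  next
    case (Suc k)
    let ?l = "map (\<lambda>i. (if i < k then t i else 1) *\<^sub>R x i) [0..<n]"
    have l: "length ?l = n" "k < n" using Suc by auto
    have "?l[k := t k *\<^sub>R x k] = map (\<lambda>i. (if i < Suc k then t i else 1) *\<^sub>R x i) [0..<n]"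
      by (rule nth_equalityI) (auto simp: nth_list_update less_Suc_eq)
    moreover have "?l[k := x k] = ?l"
      by (rule nth_equalityI) (auto simp: nth_list_update)
    moreover have "B (?l[k := t k *\<^sub>R x k]) = t k *\<^sub>R B (?l[k := x k])"
      by (rule linear_scale[OF n_linearD[OF assms l]])
    ultimately show ?case using Suc by (simp add: mult.commute)
  qed
  note all = this[of n, OF order_refl]
  have "map (\<lambda>i. (if i < n then t i else 1) *\<^sub>R x i) [0..<n] = map (\<lambda>i. t i *\<^sub>R x i) [0..<n]"
    by (rule map_cong) auto
  with all show ?thesis by (simp only:)
qed

text \<open>
  Each nonzero vector is its norm times a unit vector, and multilinearity takes the norms out; if some
  vector is zero, so is the value of the form.
\<close>

lemma bounded_formI_unit:
  assumes q: "is_norm q" and B: "n_linear n B" and c: "0 \<le> c"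
    and unit: "\<And>x. (\<And>i. i < n \<Longrightarrow> q (x i) = 1) \<Longrightarrow> norm (B (map x [0..<n])) \<le> c"
  shows "bounded_form q n B c"
  unfolding bounded_form_def
proof (intro conjI allI impI B c)
  fix xs :: "'a list" assume l: "length xs = n"
  have prod: "prod_list (map q xs) = (\<Prod>i<n. q (xs ! i))"
    by (simp add: prod.list_conv_set_nth l atLeast0LessThan)
  show "norm (B xs) \<le> c * prod_list (map q xs)"
  proof (cases "\<exists>i<n. xs ! i = 0")
    case True
    then obtain i where i: "i < n" "xs ! i = 0" by blast
    have "linear (\<lambda>y. B (xs[i := y]))" by (rule n_linearD[OF B l i(1)])
    from linear_0[OF this] have "B xs = 0"
      using i list_update_id[of xs i] by simp
    then show ?thesis using c prod_list_norms_nonneg[OF q] by simp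
  next
    case False
    then have pos: "0 < q (xs ! i)" if "i < n" for i
    proof -
      have "q (xs ! i) \<noteq> 0" using that False q by (auto simp: is_norm_def)
      then show ?thesis using is_norm_nonneg[OF q, of "xs ! i"] by linarith
    qed
    have "xs = map (\<lambda>i. q (xs ! i) *\<^sub>R (inverse (q (xs ! i)) *\<^sub>R xs ! i)) [0..<n]"
      by (rule nth_equalityI) (use pos l in \<open>auto simp: less_imp_neq[symmetric]\<close>)
    then have "B xs = B (map (\<lambda>i. q (xs ! i) *\<^sub>R (inverse (q (xs ! i)) *\<^sub>R xs ! i)) [0..<n])"
      by simp
    also have "\<dots> = (\<Prod>i<n. q (xs ! i)) *\<^sub>R
        B (map (\<lambda>i. inverse (q (xs ! i)) *\<^sub>R xs ! i) [0..<n])"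
      by (rule n_linear_scale_all[OF B])
    finally have e: "B xs = (\<Prod>i<n. q (xs ! i)) *\<^sub>R
        B (map (\<lambda>i. inverse (q (xs ! i)) *\<^sub>R xs ! i) [0..<n])" .
    have "norm (B (map (\<lambda>i. inverse (q (xs ! i)) *\<^sub>R xs ! i) [0..<n])) \<le> c"
    proof (rule unit)
      fix i assume "i < n"
      with pos[of i] show "q (inverse (q (xs ! i)) *\<^sub>R xs ! i) = 1"
        by (simp add: is_norm_scale[OF q])
    qed
    then show ?thesis unfolding e prod
      by (simp add: prod_nonneg is_norm_nonneg[OF q] mult.commute[of c] mult_left_mono)
  qed
qed

definition symmetrization :: "nat \<Rightarrow> ('a list \<Rightarrow> real) \<Rightarrow> 'a list \<Rightarrow> real" where
  "symmetrization n B xs = (\<Sum>ws\<in>permutations_of_set {..<n}. B (map (\<lambda>i. xs ! i) ws)) / fact n"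

lemma permutations_of_lessThan:
  "permutations_of_set {..<n} = {ws. set ws = {..<n} \<and> length ws = n}"
proof (rule set_eqI)
  fix ws :: "nat list"
  have "distinct ws \<longleftrightarrow> length ws = n" if "set ws = {..<n}"
    using that distinct_card[of ws] card_distinct[of ws] by auto
  then show "ws \<in> permutations_of_set {..<n} \<longleftrightarrow> ws \<in> {ws. set ws = {..<n} \<and> length ws = n}"
    unfolding permutations_of_set_def by blast
qed

lemma n_linear_symmetrization:
  assumes "n_linear n B"
  shows "n_linear n (symmetrization n B)"
  unfolding n_linear_def
proof (intro allI impI)
  fix xs :: "'a list" and i assume i: "length xs = n \<and> i < n"
  have "linear (\<lambda>y. B (map (\<lambda>j. xs[i := y] ! j) ws))" if "ws \<in> permutations_of_set {..<n}" for ws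
  proof -
    have ws: "set ws = {..<n}" "length ws = n"
      using that unfolding permutations_of_lessThan by auto
    have dist: "distinct ws" using that by (rule permutations_of_setD)
    have "i \<in> set ws" unfolding ws(1) using i by simp
    then obtain k where k: "k < length ws" "ws ! k = i"
      unfolding in_set_conv_nth by blast
    have upd: "map (\<lambda>j. xs[i := y] ! j) ws = (map (\<lambda>j. xs ! j) ws)[k := y]" for y
    proof (rule nth_equalityI)
      fix m assume "m < length (map (\<lambda>j. xs[i := y] ! j) ws)"
      then have m: "m < length ws" by simp
      then have "ws ! m \<in> set ws" by (rule nth_mem)
      then have lt: "ws ! m < length xs" unfolding ws(1) using i by simp
      have "ws ! m = i \<longleftrightarrow> m = k"
        using nth_eq_iff_index_eq[OF dist m k(1)] k(2) by simp
      then show "map (\<lambda>j. xs[i := y] ! j) ws ! m = (map (\<lambda>j. xs ! j) ws)[k := y] ! m"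
        using m lt k(1) by (cases "m = k") simp_all
    qed simp
    show ?thesis unfolding upd
      by (rule n_linearD[OF assms]) (use k ws in simp_all)
  qed
  then have "linear (\<lambda>y. \<Sum>ws\<in>permutations_of_set {..<n}. B (map (\<lambda>j. xs[i := y] ! j) ws))"
    by (intro linear_compose_sum ballI)
  from linear_compose_scale_right[OF this, of "inverse (fact n)"]
  show "linear (\<lambda>y. symmetrization n B (xs[i := y]))"
    unfolding symmetrization_def by (simp add: divide_inverse_commute)
qed

lemma symmetrization_diag: "symmetrization n B (replicate n h) = B (replicate n h)"
proof -
  have "B (map (\<lambda>i. replicate n h ! i) ws) = B (replicate n h)"
    if "ws \<in> permutations_of_set {..<n}" for ws
  proof -
    have ws: "set ws = {..<n}" "length ws = n"
      using that unfolding permutations_of_lessThan by auto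
    then have "map (\<lambda>i. replicate n h ! i) ws = map (\<lambda>_. h) ws"
      by (intro map_cong) auto
    then show ?thesis using ws by (simp add: map_replicate_const)
  qed
  then have "(\<Sum>ws\<in>permutations_of_set {..<n}. B (map (\<lambda>i. replicate n h ! i) ws)) =
      fact n * B (replicate n h)"
    by simp
  then show ?thesis by (simp add: symmetrization_def)
qed

text \<open>
  Let \<open>h T\<close> be the sum of \<open>B (map x ws)\<close> over the words \<open>ws\<close> of length \<open>n\<close> that use exactly the letters
  \<open>T\<close>. Then \<open>B\<close> on the diagonal at \<open>\<Sum>j\<in>S. x j\<close> is the sum of \<open>h T\<close> over \<open>T \<subseteq> S\<close>, and inclusion and
  exclusion recovers \<open>h {..<n}\<close>, where the words are the permutations.
\<close>

lemma symmetrization_polarization: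
  assumes "n_linear n B"
  shows "(-1) ^ n * (fact n * symmetrization n B (map x [0..<n])) =
    (\<Sum>T\<in>Pow {..<n}. (-1) ^ card T * B (replicate n (\<Sum>j\<in>T. x j)))"
proof -
  define h where "h T = (\<Sum>ws | set ws = T \<and> length ws = n. B (map x ws))" for T
  have sign_cancel: "(-1) ^ k * ((-1) ^ k * z) = z" for k and z :: real
    by (cases "even k") auto
  have "B (replicate n (\<Sum>j\<in>S. x j)) = (\<Sum>T\<in>Pow S. (-1) ^ card T * ((-1) ^ card T * h T))"
    if S: "finite S" for S
  proof -
    have fin: "finite {ws. set ws \<subseteq> S \<and> length ws = n}"
      by (rule finite_lists_length_eq[OF S])
    have "B (replicate n (\<Sum>j\<in>S. x j)) = (\<Sum>ws | set ws \<subseteq> S \<and> length ws = n. B (map x ws))"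
      using n_linear_expand_sum[OF S, of "[]" n B x] assms by simp
    also have "\<dots> = (\<Sum>T\<in>Pow S. \<Sum>ws | ws \<in> {ws. set ws \<subseteq> S \<and> length ws = n} \<and> set ws = T. B (map x ws))"
      by (rule sum.group[symmetric, OF fin]) (use S in auto)
    also have "\<dots> = (\<Sum>T\<in>Pow S. h T)"
    proof (rule sum.cong)
      fix T assume "T \<in> Pow S"
      then have "{ws. ws \<in> {ws. set ws \<subseteq> S \<and> length ws = n} \<and> set ws = T} =
          {ws. set ws = T \<and> length ws = n}" by blast
      then show "(\<Sum>ws | ws \<in> {ws. set ws \<subseteq> S \<and> length ws = n} \<and> set ws = T. B (map x ws)) = h T"
        unfolding h_def by (simp only:)
    qed simp
    finally show ?thesis unfolding sign_cancel .
  qed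
  from inclusion_exclusion_symmetric[where f = "\<lambda>T. (-1) ^ card T * h T"
      and g = "\<lambda>S. B (replicate n (\<Sum>j\<in>S. x j))", OF this finite_lessThan[of n]]
  have "(-1) ^ n * h {..<n} = (\<Sum>T\<in>Pow {..<n}. (-1) ^ card T * B (replicate n (\<Sum>j\<in>T. x j)))"
    by simp
  moreover have "h {..<n} = fact n * symmetrization n B (map x [0..<n])"
  proof -
    have eq: "map (\<lambda>i. map x [0..<n] ! i) ws = map x ws" if "set ws = {..<n}" for ws
    proof (rule map_cong[OF refl])
      fix i assume "i \<in> set ws"
      then have "i < n" unfolding that by simp
      then show "map x [0..<n] ! i = x i" by simp
    qed
    have "h {..<n} = (\<Sum>ws | set ws = {..<n} \<and> length ws = n. B (map (\<lambda>i. map x [0..<n] ! i) ws))"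
      unfolding h_def by (rule sum.cong[OF refl]) (simp only: mem_Collect_eq eq)
    then show ?thesis unfolding symmetrization_def permutations_of_lessThan by simp
  qed
  ultimately show ?thesis by simp
qed

lemma power_self_le_fact_exp: "real n ^ n \<le> fact n * exp 1 ^ n"
proof -
  have "real n ^ n /\<^sub>R fact n \<le> exp (real n)"
    unfolding exp_def using sum_le_suminf[OF summable_exp_generic[of "real n"], of "{n}"] by simp
  also have "exp (real n) = exp 1 ^ n"
    using exp_of_nat_mult[of n 1] by simp
  finally show ?thesis by (simp add: field_simps)
qed

text \<open>
  The continuity of a homogeneous polynomial bounds only the diagonal of its form. Polarization has
  \<open>2 ^ n\<close> terms, each at a vector of norm at most \<open>n\<close>, and \<open>n ^ n / fact n \<le> exp 1 ^ n\<close>: passing to the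
  symmetric form costs only a constant factor in the radius.
\<close>

lemma bounded_form_symmetrization:
  assumes q: "is_norm q" and B: "n_linear n B" and A: "0 \<le> A"
    and diag: "\<And>h. \<bar>B (replicate n h)\<bar> \<le> A * q h ^ n"
  shows "bounded_form q n (symmetrization n B) (A * (2 * exp 1) ^ n)"
proof (rule bounded_formI_unit[OF q n_linear_symmetrization[OF B]])
  show "0 \<le> A * (2 * exp 1) ^ n" using A by simp
  fix x :: "nat \<Rightarrow> 'a" assume x: "\<And>i. i < n \<Longrightarrow> q (x i) = 1"
  let ?s = "symmetrization n B (map x [0..<n])"
  have term_le: "\<bar>(-1) ^ card T * B (replicate n (\<Sum>j\<in>T. x j))\<bar> \<le> A * real n ^ n" if "T \<in> Pow {..<n}" for T
  proof -
    have T: "finite T" "card T \<le> n"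
      using that finite_subset card_mono[of "{..<n}" T] by auto
    have "q (\<Sum>j\<in>T. x j) \<le> (\<Sum>j\<in>T. q (x j))"
      using T(1)
    proof (induction T)
      case (insert j T)
      then show ?case using is_norm_add[OF q, of "x j" "\<Sum>j\<in>T. x j"] by simp
    qed (simp add: is_norm_zero[OF q])
    also have "\<dots> = card T" using that x by (auto simp: subset_iff)
    finally have "q (\<Sum>j\<in>T. x j) \<le> n" using T by linarith
    then have "A * q (\<Sum>j\<in>T. x j) ^ n \<le> A * real n ^ n"
      by (intro mult_left_mono power_mono is_norm_nonneg[OF q] A)
    then show ?thesis using diag[of "\<Sum>j\<in>T. x j"] by (simp add: abs_mult power_abs)
  qed
  have "fact n * \<bar>?s\<bar> = \<bar>(-1) ^ n * (fact n * ?s)\<bar>"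
    by (simp add: abs_mult power_abs)
  also have "\<dots> \<le> (\<Sum>T\<in>Pow {..<n}. A * real n ^ n)"
    unfolding symmetrization_polarization[OF B]
    by (rule order_trans[OF sum_abs sum_mono[OF term_le]])
  also have "\<dots> = 2 ^ n * (A * real n ^ n)" by (simp add: card_Pow)
  also have "\<dots> \<le> 2 ^ n * (A * (fact n * exp 1 ^ n))"
    by (intro mult_left_mono power_self_le_fact_exp A) auto
  also have "\<dots> = fact n * (A * (2 * exp 1) ^ n)" by (simp add: power_mult_distrib)
  finally show "norm ?s \<le> A * (2 * exp 1) ^ n" by simp
qed

section \<open>Uniformly analytic functions\<close>

lemma openin_norm_topology:
  assumes q: "is_norm q"
  shows "openin (mtopology_of (norm_metric q)) U \<longleftrightarrow> (\<forall>x\<in>U. \<exists>r>0. \<forall>y. q (y - x) < r \<longrightarrow> y \<in> U)"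
proof -
  interpret Metric_space UNIV "\<lambda>x y. q (x - y)" by (rule Metric_space_norm[OF q])
  have "mtopology_of (norm_metric q) = mtopology"
    by (simp add: norm_metric_def)
  then show ?thesis
    by (simp add: openin_mtopology mball_def subset_iff Ball_def is_norm_minus_commute[OF q])
qed

lemma norm_topology_continuousD:
  fixes P :: "'a::real_vector \<Rightarrow> 'b::real_normed_vector"
  assumes q: "is_norm q" and P: "continuous_map (mtopology_of (norm_metric q)) euclidean P"
    and e: "0 < e"
  shows "\<exists>d>0. \<forall>y. q (y - x) < d \<longrightarrow> dist (P y) (P x) < e"
proof -
  have "openin (mtopology_of (norm_metric q)) {y \<in> topspace (mtopology_of (norm_metric q)). P y \<in> ball (P x) e}"
    by (rule openin_continuous_map_preimage[OF P]) simp
  moreover have "topspace (mtopology_of (norm_metric q)) = UNIV"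
    by (metis Metric_space.mspace_metric Metric_space_norm norm_metric_def q topspace_mtopology_of)
  ultimately have "openin (mtopology_of (norm_metric q)) {y. P y \<in> ball (P x) e}" by simp
  then show ?thesis
    unfolding openin_norm_topology[OF q] using e by (auto simp: dist_commute)
qed

lemma homogeneous_polynomial_scale:
  "homogeneous_polynomial n P \<Longrightarrow> P (t *\<^sub>R h) = t ^ n *\<^sub>R P h"
  unfolding homogeneous_polynomial_def using n_linear_diag_scale by metis

lemma homogeneous_polynomial_ball_bound:
  assumes q: "is_norm q" and P: "homogeneous_polynomial n P" and d: "0 < d"
    and A: "\<And>h. q h \<le> d \<Longrightarrow> norm (P h) \<le> A"
  shows "norm (P h) \<le> A / d ^ n * q h ^ n"
proof (cases "q h = 0")
  case True
  then have h: "h = 0" using q by (simp add: is_norm_def)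
  have "norm (P 0) \<le> A" using A[of 0] d by (simp add: is_norm_zero[OF q])
  moreover have "P 0 = 0 ^ n *\<^sub>R P 0"
    using homogeneous_polynomial_scale[OF P, of 0 0] by simp
  ultimately show ?thesis using h True by (cases n) auto
next
  case False
  then have pos: "0 < q h" using is_norm_nonneg[OF q, of h] by simp
  let ?t = "d / q h"
  have t: "0 < ?t" using pos d by simp
  have "norm (P (?t *\<^sub>R h)) \<le> A"
    by (rule A) (use pos d in \<open>simp add: is_norm_scale[OF q]\<close>)
  then have "?t ^ n * norm (P h) \<le> A"
    unfolding homogeneous_polynomial_scale[OF P] using pos d by simp
  then show ?thesis using pos d by (simp add: power_divide field_simps)
qed

text \<open>
  At the supremum \<open>z\<close> of the points up to which \<open>u\<close> vanishes, zeros accumulate from the left, so the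
  power series at \<open>z\<close> is trivial and \<open>u\<close> vanishes beyond \<open>z\<close>.
\<close>

lemma real_power_series_vanish:
  fixes u :: "real \<Rightarrow> real"
  assumes ps: "\<And>t. t \<in> {0..1} \<Longrightarrow> \<exists>c \<delta>. 0 < \<delta> \<and> (\<forall>s. \<bar>s\<bar> < \<delta> \<longrightarrow> (\<lambda>n. c n * s ^ n) sums u (t + s))"
    and d: "0 < d" "\<And>s. 0 \<le> s \<Longrightarrow> s < d \<Longrightarrow> u s = 0"
  shows "u 1 = 0"
proof -
  define E where "E = {t \<in> {0..1}. \<forall>s\<in>{0..t}. u s = 0}"
  define z where "z = Sup E"
  have zero: "0 \<in> E" using d by (auto simp: E_def)
  have bdd: "bdd_above E" by (rule bdd_aboveI[of _ 1]) (simp add: E_def)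
  have zE: "0 \<le> z" "z \<le> 1"
    unfolding z_def using zero by (auto intro!: cSup_upper bdd cSup_least simp: E_def)
  have below: "u s = 0" if "0 \<le> s" "s < z" for s
  proof -
    have "E \<noteq> {}" using zero by blast
    with \<open>s < z\<close> obtain t where "t \<in> E" "s < t"
      unfolding z_def by (rule less_cSupE)
    then show ?thesis using that by (auto simp: E_def)
  qed
  have zpos: "0 < z"
  proof -
    have "min (d / 2) 1 \<in> E" using d by (auto simp: E_def)
    from cSup_upper[OF this bdd] show ?thesis using d by (simp add: z_def)
  qed
  obtain c \<delta> where c: "0 < \<delta>" "\<And>s. \<bar>s\<bar> < \<delta> \<Longrightarrow> (\<lambda>n. c n * s ^ n) sums u (z + s)"
  proof -
    have "z \<in> {0..1}" using zE by simp
    from ps[OF this] show ?thesis using that by blast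
  qed
  have c0: "c m = 0" for m
  proof (rule ccontr)
    assume m: "c m \<noteq> 0"
    \<comment> \<open>Isolation of zeros is applied to \<open>s * u (z + s)\<close>, which vanishes at \<open>s = 0\<close> whatever the value of \<open>u z\<close>.\<close>
    define a where "a n = (case n of 0 \<Rightarrow> 0 | Suc k \<Rightarrow> c k)" for n
    have "(\<lambda>n. a n * (s - 0) ^ n) sums (s * u (z + s))" if "norm (s - 0) < \<delta>" for s
    proof -
      have "(\<lambda>n. s * (c n * s ^ n)) sums (s * u (z + s))"
        using c(2)[of s] that by (intro sums_mult) simp
      then have "(\<lambda>n. a (Suc n) * s ^ Suc n) sums (s * u (z + s))"
        by (simp add: a_def mult_ac)
      from sums_Suc[OF this] show ?thesis by (simp add: a_def)
    qed
    note ser = this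
    have "a (Suc m) \<noteq> 0" using m by (simp add: a_def)
    with c(1) ser mult_zero_left[of "u (z + 0)"] obtain e where e: "0 < e" "\<And>s. s \<in> cball 0 e - {0} \<Longrightarrow> s * u (z + s) \<noteq> 0"
      by (rule powser_0_nonzero[of \<delta> 0 a "\<lambda>s. s * u (z + s)" "Suc m"]) simp_all
    define s where "s = - min e (z / 2)"
    have "u (z + s) \<noteq> 0" using e(2)[of s] e(1) zpos by (auto simp: s_def)
    moreover have "u (z + s) = 0" using below[of "z + s"] e(1) zpos by (auto simp: s_def min_def)
    ultimately show False by simp
  qed
  have near: "u (z + s) = 0" if "\<bar>s\<bar> < \<delta>" for s
    using sums_unique[OF c(2)[OF that]] by (simp add: c0)
  have all: "u s = 0" if "0 \<le> s" "s < z + \<delta>" for s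
    using below[of s] near[of "s - z"] that c(1) by (cases "s < z") auto
  have "z = 1"
  proof (rule ccontr)
    assume "z \<noteq> 1"
    with zE have "z < 1" by simp
    have "min 1 (z + \<delta> / 2) \<in> E" using all c(1) zpos by (auto simp: E_def)
    from cSup_upper[OF this bdd] show False using c(1) \<open>z < 1\<close> by (simp add: z_def[symmetric])
  qed
  then show ?thesis using all[of 1] c(1) by simp
qed

lemma power_series_at_local:
  assumes q: "is_norm q" and P: "power_series_at (mtopology_of (norm_metric q)) F x P"
  obtains r where "0 < r" "\<And>h. q h < r \<Longrightarrow> (\<lambda>n. P n h) sums F (x + h)"
    "\<And>n. homogeneous_polynomial n (P n)"
    "\<And>n. continuous_map (mtopology_of (norm_metric q)) euclidean (P n)"
proof -
  obtain U V where UV: "openin (mtopology_of (norm_metric q)) U" "0 \<in> U" "U \<subseteq> V"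
    "uniform_limit V (\<lambda>N h. \<Sum>n<N. P n h) (\<lambda>h. F (x + h)) sequentially"
    using P unfolding power_series_at_def by blast
  obtain r where r: "0 < r" "\<And>y. q (y - 0) < r \<Longrightarrow> y \<in> U"
    using UV(1,2) unfolding openin_norm_topology[OF q] by blast
  have "(\<lambda>n. P n h) sums F (x + h)" if "q h < r" for h
    unfolding sums_def using r(2)[of h] that UV(3)
    by (intro tendsto_uniform_limitI[OF UV(4)]) auto
  then show ?thesis using that r(1) P unfolding power_series_at_def by blast
qed

text \<open>
  A power series of \<open>Q\<close> may converge on a ball on which its sum is not known to be \<open>Q\<close>. Along a segment
  both are locally sums of power series in one real variable, so they agree on the whole ball.
\<close>

lemma majorized_identity:
  fixes Q S :: "'a::real_vector \<Rightarrow> real"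
  assumes q: "is_norm q" and Q: "analytic_map (mtopology_of (norm_metric q)) Q"
    and S: "majorized q x \<rho> S M"
    and near: "0 < d" "\<And>h. q h < d \<Longrightarrow> Q (x + h) = S (x + h)" and h: "q h < \<rho>"
  shows "Q (x + h) = S (x + h)"
proof -
  define u where "u t = Q (x + t *\<^sub>R h) - S (x + t *\<^sub>R h)" for t
  have qh: "0 \<le> q h" by (rule is_norm_nonneg[OF q])
  have "u 1 = 0"
  proof (rule real_power_series_vanish)
    show "0 < d / (q h + 1)" using near qh by simp
    show "u s = 0" if "0 \<le> s" "s < d / (q h + 1)" for s
    proof -
      have "s * q h \<le> s * (q h + 1)" using that qh by (intro mult_left_mono) auto
      also have "\<dots> < d" using that qh by (simp add: field_simps)
      finally show ?thesis using near(2)[of "s *\<^sub>R h"] that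
        by (simp add: u_def is_norm_scale[OF q])
    qed
    fix t :: real assume t: "t \<in> {0..1}"
    define y where "y = x + t *\<^sub>R h"
    define r where "r = \<rho> - q h"
    have r: "0 < r" using h by (simp add: r_def)
    have "q (y - x) \<le> q h"
      using t qh by (simp add: y_def is_norm_scale[OF q] mult_left_le_one_le)
    then have "majorized q y r S M"
      using majorized_recentre[OF q, of x "q h" r S M y] S r by (simp add: r_def)
    then obtain B b where B: "\<And>n. bounded_form q n (B n) (b n)"
      "\<And>k. q k \<le> r \<Longrightarrow> (\<lambda>n. B n (replicate n k)) sums S (y + k)"
      by (rule majorizedE) blast
    obtain P where "power_series_at (mtopology_of (norm_metric q)) Q y P"
      using Q unfolding analytic_map_def by blast
    then obtain r' where P: "0 < r'" "\<And>k. q k < r' \<Longrightarrow> (\<lambda>n. P n k) sums Q (y + k)"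
      "\<And>n. homogeneous_polynomial n (P n)"
      by (rule power_series_at_local[OF q]) blast
    define \<delta> where "\<delta> = min r r' / (q h + 1)"
    have "(\<lambda>n. (P n h - B n (replicate n h)) * s ^ n) sums u (t + s)" if s: "\<bar>s\<bar> < \<delta>" for s
    proof -
      have "\<bar>s\<bar> * q h \<le> \<bar>s\<bar> * (q h + 1)" using qh by (intro mult_left_mono) auto
      also have "\<dots> < min r r'" using s qh by (simp add: \<delta>_def field_simps)
      finally have *: "q (s *\<^sub>R h) < min r r'" by (simp add: is_norm_scale[OF q])
      have "(\<lambda>n. P n (s *\<^sub>R h) - B n (replicate n (s *\<^sub>R h))) sums (Q (y + s *\<^sub>R h) - S (y + s *\<^sub>R h))"
        by (intro sums_diff P B) (use * in auto)
      moreover have "P n (s *\<^sub>R h) - B n (replicate n (s *\<^sub>R h)) =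
          (P n h - B n (replicate n h)) * s ^ n" for n
        using homogeneous_polynomial_scale[OF P(3), of n s h] n_linear_diag_scale[of n "B n" s h] B(1)[of n]
        by (simp add: bounded_form_def algebra_simps)
      moreover have "y + s *\<^sub>R h = x + (t + s) *\<^sub>R h" by (simp add: y_def algebra_simps)
      ultimately show ?thesis by (simp add: u_def)
    qed
    moreover have "0 < \<delta>" using r P(1) qh by (simp add: \<delta>_def)
    ultimately show "\<exists>c \<delta>. 0 < \<delta> \<and> (\<forall>s. \<bar>s\<bar> < \<delta> \<longrightarrow> (\<lambda>n. c n * s ^ n) sums u (t + s))"
      by (intro exI[of _ "\<lambda>n. P n h - B n (replicate n h)"] exI[of _ \<delta>]) simp
  qed
  then show ?thesis by (simp add: u_def)
qed

text \<open>
  Uniform convergence bounds all but finitely many terms on the ball by one; the remaining ones are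
  continuous, hence bounded near zero and, by homogeneity, on every ball.
\<close>

lemma power_series_terms_bounded:
  fixes P :: "nat \<Rightarrow> 'a::real_vector \<Rightarrow> real"
  assumes q: "is_norm q" and hom: "\<And>n. homogeneous_polynomial n (P n)"
    and cont: "\<And>n. continuous_map (mtopology_of (norm_metric q)) euclidean (P n)"
    and r: "0 < r" and conv: "uniformly_convergent_on {h. q h \<le> r} (\<lambda>N h. \<Sum>n<N. P n h)"
  obtains A where "0 \<le> A" "\<And>n h. \<bar>P n h\<bar> \<le> A / r ^ n * q h ^ n"
proof -
  have "\<exists>C. \<forall>h. q h \<le> r \<longrightarrow> \<bar>P n h\<bar> \<le> C" for n
  proof -
    obtain d where d: "0 < d" "\<And>y. q (y - 0) < d \<Longrightarrow> dist (P n y) (P n 0) < 1"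
      using norm_topology_continuousD[OF q cont, of 1 0 n] by auto
    have "norm (P n h) \<le> (\<bar>P n 0\<bar> + 1) / (d / 2) ^ n * q h ^ n" for h
    proof (rule homogeneous_polynomial_ball_bound[OF q hom])
      show "0 < d / 2" using d by simp
      show "norm (P n h) \<le> \<bar>P n 0\<bar> + 1" if "q h \<le> d / 2" for h
        using d(2)[of h] that d(1) by (simp add: dist_real_def)
    qed
    moreover have "(\<bar>P n 0\<bar> + 1) / (d / 2) ^ n * q h ^ n \<le> (\<bar>P n 0\<bar> + 1) / (d / 2) ^ n * r ^ n"
      if "q h \<le> r" for h
      using d(1) that by (intro mult_left_mono power_mono is_norm_nonneg[OF q]) auto
    ultimately show ?thesis by (metis order_trans real_norm_def)
  qed
  then obtain C where C: "\<And>n h. q h \<le> r \<Longrightarrow> \<bar>P n h\<bar> \<le> C n" by metis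
  have C0: "0 \<le> C n" for n
    using C[of 0 n] r by (simp add: is_norm_zero[OF q] order_trans[OF abs_ge_zero])
  have "uniformly_Cauchy_on {h. q h \<le> r} (\<lambda>N h. \<Sum>n<N. P n h)"
    using conv by (rule uniformly_convergent_Cauchy)
  then obtain N where N: "\<And>h m n. q h \<le> r \<Longrightarrow> m \<ge> N \<Longrightarrow> n \<ge> N \<Longrightarrow>
      dist (\<Sum>k<m. P k h) (\<Sum>k<n. P k h) < 1"
    unfolding uniformly_Cauchy_on_def by (metis mem_Collect_eq zero_less_one)
  define A where "A = 1 + (\<Sum>n<N. C n)"
  have A: "1 \<le> A" by (simp add: A_def sum_nonneg C0)
  have "norm (P n h) \<le> A" if "q h \<le> r" for n h
  proof (cases "n < N")
    case True
    then have "C n \<le> (\<Sum>n<N. C n)" by (intro member_le_sum) (auto simp: C0)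
    then show ?thesis using C[OF that, of n] by (simp add: A_def)
  next
    case False
    then show ?thesis using N[OF that, of "Suc n" n] A by (simp add: dist_real_def)
  qed
  then have "norm (P n h) \<le> A / r ^ n * q h ^ n" for n h
    by (rule homogeneous_polynomial_ball_bound[OF q hom r])
  then show ?thesis using that[of A] A by auto
qed

text \<open>
  The convergence radius bounds the terms on a ball of radius \<open>r\<close>; after polarization the forms are
  summable with radius \<open>r / (4 * exp 1)\<close>, where the series is geometric with ratio \<open>1 / 2\<close>.
\<close>

lemma uniformly_analytic_majorized:
  fixes Q :: "'a::real_vector \<Rightarrow> real"
  assumes q: "is_norm q" and Q: "analytic_map (mtopology_of (norm_metric q)) Q" and R: "0 < R"
    and PR: "\<And>x. \<exists>P. power_series_at (mtopology_of (norm_metric q)) Q x P \<and>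
        ereal R \<le> convergence_radius q P"
  shows "\<exists>\<rho>>0. \<forall>x. \<exists>M. majorized q x \<rho> Q M"
proof -
  define r where "r = R / 2"
  define \<rho> where "\<rho> = r / (4 * exp 1)"
  have r: "0 < r" "0 < \<rho>" using R by (auto simp: r_def \<rho>_def)
  have "\<exists>M. majorized q x (\<rho> / 2) Q M" for x
  proof -
    obtain P where P: "power_series_at (mtopology_of (norm_metric q)) Q x P"
      "ereal R \<le> convergence_radius q P" using PR by blast
    have "ereal r < convergence_radius q P"
      by (rule less_le_trans[OF _ P(2)]) (use R in \<open>simp add: r_def\<close>)
    then obtain r' where r': "r < r'" "uniformly_convergent_on {h. q h \<le> r'} (\<lambda>N h. \<Sum>n<N. P n h)"
      unfolding convergence_radius_def less_Sup_iff by auto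
    have conv: "uniformly_convergent_on {h. q h \<le> r} (\<lambda>N h. \<Sum>n<N. P n h)"
      by (rule uniformly_convergent_on_subset[OF r'(2)]) (use r'(1) in auto)
    obtain d where d: "0 < d" "\<And>h. q h < d \<Longrightarrow> (\<lambda>n. P n h) sums Q (x + h)"
      "\<And>n. homogeneous_polynomial n (P n)"
      "\<And>n. continuous_map (mtopology_of (norm_metric q)) euclidean (P n)"
      by (rule power_series_at_local[OF q P(1)]) blast
    obtain A where A: "0 \<le> A" "\<And>n h. \<bar>P n h\<bar> \<le> A / r ^ n * q h ^ n"
      by (rule power_series_terms_bounded[OF q d(3,4) r(1) conv]) blast
    have "\<exists>B. n_linear n B \<and> (\<forall>h. P n h = B (replicate n h))" for n
      using d(3)[of n] unfolding homogeneous_polynomial_def .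
    then obtain B where B: "\<And>n. n_linear n (B n)" "\<And>n h. P n h = B n (replicate n h)" by metis
    define S where "S y = (\<Sum>n. P n (y - x))" for y
    have val: "A / r ^ n * (2 * exp 1) ^ n * \<rho> ^ n = A * (1 / 2) ^ n" for n
    proof -
      have half: "2 * exp 1 * \<rho> / r = 1 / 2" using r(1) by (simp add: \<rho>_def)
      have "A / r ^ n * (2 * exp 1) ^ n * \<rho> ^ n = A * (2 * exp 1 * \<rho> / r) ^ n"
        by (simp only: power_divide power_mult_distrib) simp
      then show ?thesis unfolding half .
    qed
    have geo: "summable (\<lambda>n. A * (1 / 2 :: real) ^ n)"
      by (intro summable_mult summable_geometric) simp
    have "majorized q x \<rho> S (\<Sum>n. A * (1 / 2) ^ n)"
    proof (rule majorizedI[of q "\<lambda>n. symmetrization n (B n)" "\<lambda>n. A / r ^ n * (2 * exp 1) ^ n"])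
      show form: "bounded_form q n (symmetrization n (B n)) (A / r ^ n * (2 * exp 1) ^ n)" for n
        by (rule bounded_form_symmetrization[OF q B(1)]) (use A B(2) r in auto)
      show "summable (\<lambda>n. A / r ^ n * (2 * exp 1) ^ n * \<rho> ^ n)" unfolding val by (rule geo)
      show "(\<Sum>n. A / r ^ n * (2 * exp 1) ^ n * \<rho> ^ n) \<le> (\<Sum>n. A * (1 / 2) ^ n)"
        unfolding val by simp
      fix h assume h: "q h \<le> \<rho>"
      have "summable (\<lambda>n. P n h)"
      proof (rule summable_comparison_test'[OF geo, where N = 0])
        show "norm (P n h) \<le> A * (1 / 2) ^ n" for n
          using bounded_form_diag_le[OF q form h, of n] unfolding val symmetrization_diag B(2) .
      qed
      then show "(\<lambda>n. symmetrization n (B n) (replicate n h)) sums S (x + h)"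
        unfolding S_def symmetrization_diag B(2)[symmetric] by (simp add: summable_sums)
    qed
    note S = this
    have "Q (x + h) = S (x + h)" if "q h < d" for h
      using sums_unique[OF d(2)[OF that]] by (simp add: S_def)
    then have "Q (x + h) = S (x + h)" if "q h < \<rho>" for h
      by (rule majorized_identity[OF q Q S d(1) _ that])
    then have "majorized q x (\<rho> / 2) Q (\<Sum>n. A * (1 / 2) ^ n) =
        majorized q x (\<rho> / 2) S (\<Sum>n. A * (1 / 2) ^ n)"
      using r by (intro majorized_cong) auto
    then show ?thesis using majorized_shrink[OF q S, of "\<rho> / 2"] r by auto
  qed
  then show ?thesis using r by (intro exI[of _ "\<rho> / 2"]) auto
qed

lemma majorized_continuous_at:
  fixes F :: "'a::real_vector \<Rightarrow> 'b::banach"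
  assumes q: "is_norm q" and F: "majorized q x r F M" and r: "0 < r" and e: "0 < e"
  shows "\<exists>d>0. \<forall>y. q (y - x) \<le> d \<longrightarrow> norm (F y - F x) \<le> e"
proof -
  define d where "d = min r (r * e / (M + 1))"
  have M: "0 \<le> M" using majorized_nonneg[OF F] r by simp
  have d: "0 < d" "d \<le> r" using r e M by (auto simp: d_def)
  have "d * M \<le> (r * e / (M + 1)) * (M + 1)"
    using M r e by (intro mult_mono) (auto simp: d_def)
  also have "\<dots> = r * e" using M by simp
  finally have "d / r * M \<le> e" using r by (simp add: field_simps)
  have "norm (F y - F x) \<le> e" if "q (y - x) \<le> d" for y
    using majorized_norm_le[OF q majorized_minus_centre[OF q F d] that] \<open>d / r * M \<le> e\<close> by simp
  then show ?thesis using d by blast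
qed

text \<open>
  The terms of the series are continuous for \<open>T\<close> because they are themselves majorized at every point;
  the series converges uniformly by the Weierstrass test.
\<close>

lemma majorized_imp_analytic_map:
  fixes F :: "'a::real_vector \<Rightarrow> 'b::banach"
  assumes q: "is_norm q" and T: "topspace T = UNIV"
    and op: "\<And>U. openin (mtopology_of (norm_metric q)) U \<Longrightarrow> openin T U"
    and F: "\<And>x. \<exists>r M. 0 < r \<and> majorized q x r F M"
  shows "analytic_map T F"
  unfolding analytic_map_def
proof
  fix x
  obtain r M where r: "0 < r" "majorized q x r F M" using F by blast
  obtain B b where B: "\<And>n. bounded_form q n (B n) (b n)" "summable (\<lambda>n. b n * r ^ n)"
    "\<And>h. q h \<le> r \<Longrightarrow> (\<lambda>n. B n (replicate n h)) sums F (x + h)"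
    using r(2) by (rule majorizedE) blast
  define P where "P n h = B n (replicate n h)" for n h
  have poly: "homogeneous_polynomial n (P n)" for n
    unfolding homogeneous_polynomial_def P_def
    by (rule exI[of _ "B n"]) (use B(1)[of n] in \<open>simp add: bounded_form_def\<close>)
  have cont: "continuous_map T euclidean (P n)" for n
  proof -
    have "openin (mtopology_of (norm_metric q)) {y. P n y \<in> U}" if U: "open U" for U
      unfolding openin_norm_topology[OF q]
    proof
      fix y assume "y \<in> {y. P n y \<in> U}"
      then obtain e where e: "0 < e" "\<And>z. dist z (P n y) < e \<Longrightarrow> z \<in> U"
        using U unfolding open_dist by auto
      have "majorized q 0 (q y + 1) (\<lambda>u. B n (replicate n (u - 0))) (b n * (q y + 1) ^ n)"
        by (rule majorized_monomial[OF q B(1)])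
      then have "majorized q 0 (q y + 1) (P n) (b n * (q y + 1) ^ n)"
        by (simp add: P_def[abs_def])
      then have "majorized q y 1 (P n) (b n * (q y + 1) ^ n)"
        by (rule majorized_recentre[OF q, where x = 0 and s = "q y", OF _ zero_less_one])
          simp
      from majorized_continuous_at[OF q this _ half_gt_zero[OF e(1)]]
      obtain d where d: "0 < d" "\<And>z. q (z - y) \<le> d \<Longrightarrow> norm (P n z - P n y) \<le> e / 2" by auto
      have "P n z \<in> U" if "q (z - y) < d" for z
        by (rule e(2)) (use d(2)[of z] that e(1) in \<open>simp add: dist_norm\<close>)
      then show "\<exists>r>0. \<forall>z. q (z - y) < r \<longrightarrow> z \<in> {y. P n y \<in> U}"
        using d(1) by auto
    qed
    then show ?thesis unfolding continuous_map_def using op by (simp add: T)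
  qed
  have "uniform_limit {h. q h < r} (\<lambda>N h. \<Sum>n<N. P n h) (\<lambda>h. \<Sum>n. P n h) sequentially"
    by (rule Weierstrass_m_test[OF _ B(2)]) (auto simp: P_def intro: bounded_form_diag_le[OF q B(1)])
  also have "?this \<longleftrightarrow> uniform_limit {h. q h < r} (\<lambda>N h. \<Sum>n<N. P n h) (\<lambda>h. F (x + h)) sequentially"
  proof (rule uniform_limit_cong'[OF refl])
    show "(\<Sum>n. P n h) = F (x + h)" if "h \<in> {h. q h < r}" for h
      using sums_unique[OF B(3)[of h]] that by (simp add: P_def)
  qed
  finally have lim: "uniform_limit {h. q h < r} (\<lambda>N h. \<Sum>n<N. P n h) (\<lambda>h. F (x + h)) sequentially" .
  have "openin (mtopology_of (norm_metric q)) {h. q h < r}"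
    unfolding openin_norm_topology[OF q]
  proof
    fix y assume y: "y \<in> {h. q h < r}"
    have "q z < r" if "q (z - y) < r - q y" for z
      using is_norm_add[OF q, of "z - y" y] that by simp
    then show "\<exists>e>0. \<forall>z. q (z - y) < e \<longrightarrow> z \<in> {h. q h < r}"
      using y by (intro exI[of _ "r - q y"]) auto
  qed
  then have "openin T {h. q h < r}" by (rule op)
  moreover have "0 \<in> {h. q h < r}" using r(1) is_norm_zero[OF q] by simp
  ultimately have "power_series_at T F x P"
    unfolding power_series_at_def using poly cont lim by blast
  then show "\<exists>P. power_series_at T F x P" by (rule exI[of _ P])
qed

section \<open>Weighted coordinates and Gaussian bumps\<close>

lemma majorized_affine:
  assumes q: "is_norm q" and l: "0 < l" and F: "majorized q (e + l *\<^sub>R (x - c)) r F M"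
  shows "majorized q x (r / l) (\<lambda>y. F (e + l *\<^sub>R (y - c))) M"
proof -
  obtain B b where B: "\<And>n. bounded_form q n (B n) (b n)" "summable (\<lambda>n. b n * r ^ n)"
    "(\<Sum>n. b n * r ^ n) \<le> M"
    "\<And>h. q h \<le> r \<Longrightarrow> (\<lambda>n. B n (replicate n h)) sums F (e + l *\<^sub>R (x - c) + h)"
    using F by (rule majorizedE) blast
  have lin: "n_linear n (B n)" for n using B(1)[of n] by (simp add: bounded_form_def)
  have val: "l ^ n * b n * (r / l) ^ n = b n * r ^ n" for n
    using l by (simp add: power_divide)
  show ?thesis
  proof (rule majorizedI[of q "\<lambda>n xs. l ^ n *\<^sub>R B n xs" "\<lambda>n. l ^ n * b n"])
    show "bounded_form q n (\<lambda>xs. l ^ n *\<^sub>R B n xs) (l ^ n * b n)" for n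
      using B(1)[of n] l unfolding bounded_form_def n_linear_def
      by (auto intro: linear_compose_scale_right simp: mult.assoc)
    show "summable (\<lambda>n. l ^ n * b n * (r / l) ^ n)" unfolding val by (rule B(2))
    show "(\<Sum>n. l ^ n * b n * (r / l) ^ n) \<le> M" unfolding val by (rule B(3))
    fix h assume "q h \<le> r / l"
    then have "q (l *\<^sub>R h) \<le> r" using l by (simp add: is_norm_scale[OF q] field_simps)
    from B(4)[OF this]
    show "(\<lambda>n. l ^ n *\<^sub>R B n (replicate n h)) sums F (e + l *\<^sub>R (x + h - c))"
      unfolding n_linear_diag_scale[OF lin] by (simp add: algebra_simps)
  qed
qed

text \<open>
  The weight of index \<open>j\<close> is chosen against the majorants of \<open>Q j\<close> at the first \<open>j\<close> points of a dense
  sequence. Every \<open>x\<close> is within \<open>\<rho> / 2\<close> of some \<open>c l\<close>, whose majorants remain valid at \<open>x\<close> with radius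
  \<open>\<rho> / 2\<close>, so all indices \<open>j \<ge> l\<close> are controlled by a geometric series; shrinking the radius by a
  factor \<open>t\<close> then makes the whole sum small.
\<close>

lemma square_summing_weights:
  fixes Q :: "nat \<Rightarrow> 'a::real_vector \<Rightarrow> real"
  assumes q: "is_norm q" and c: "\<And>x e. 0 < e \<Longrightarrow> \<exists>l::nat. q (x - c l) < e" and \<rho>: "0 < \<rho>"
    and Q: "\<And>j x. \<exists>M. majorized q x \<rho> (Q j) M"
  obtains \<kappa> where "\<And>j. 0 < \<kappa> j" "\<And>j. \<kappa> j \<le> 1" "decseq \<kappa>"
    "\<And>x \<eta>. 0 < \<eta> \<Longrightarrow> \<exists>r>0. \<exists>\<delta>. (\<forall>j. majorized q x r (\<lambda>y. Q j y - Q j x) (\<delta> j)) \<and>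
       (\<forall>n. (\<Sum>j\<le>n. \<kappa> j * (\<delta> j)\<^sup>2) \<le> \<eta>)"
proof -
  define M where "M j l = (SOME M. majorized q (c l) \<rho> (Q j) M)" for j l
  have M: "majorized q (c l) \<rho> (Q j) (M j l)" for j l
    unfolding M_def by (rule someI_ex[OF Q])
  have M0: "0 \<le> M j l" for j l using majorized_nonneg[OF M] \<rho> by simp
  define K where "K j = 1 + (\<Sum>i\<le>j. \<Sum>l\<le>j. M i l)" for j
  have K1: "1 \<le> K j" for j by (simp add: K_def sum_nonneg M0)
  have Kmono: "K i \<le> K j" if "i \<le> j" for i j
  proof -
    have "(\<Sum>a\<le>i. \<Sum>l\<le>i. M a l) \<le> (\<Sum>a\<le>i. \<Sum>l\<le>j. M a l)"
      by (intro sum_mono sum_mono2) (use that M0 in auto)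
    also have "\<dots> \<le> (\<Sum>a\<le>j. \<Sum>l\<le>j. M a l)"
      by (intro sum_mono2) (use that M0 in \<open>auto intro: sum_nonneg\<close>)
    finally show ?thesis by (simp add: K_def)
  qed
  have MK: "M j l \<le> K j" if "l \<le> j" for j l
  proof -
    have "M j l \<le> (\<Sum>l\<le>j. M j l)" by (rule member_le_sum) (use that M0 in auto)
    also have "\<dots> \<le> (\<Sum>i\<le>j. \<Sum>l\<le>j. M i l)"
      by (rule member_le_sum[where f = "\<lambda>i. \<Sum>l\<le>j. M i l"]) (use M0 in \<open>auto intro: sum_nonneg\<close>)
    finally show ?thesis by (simp add: K_def)
  qed
  define \<kappa> where "\<kappa> j = (1 / 2) ^ j / (K j)\<^sup>2" for j
  have K0: "0 < K j" for j using K1[of j] by linarith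
  have Ksq: "1 \<le> (K j)\<^sup>2" for j using K1[of j] by (simp add: one_le_power)
  have pos: "0 < \<kappa> j" for j using K0[of j] by (simp add: \<kappa>_def)
  have le1: "\<kappa> j \<le> 1" for j
  proof -
    have "(1 / 2 :: real) ^ j \<le> 1" by (simp add: power_le_one)
    then show ?thesis using Ksq[of j] K0[of j] by (simp add: \<kappa>_def divide_le_eq_1)
  qed
  have dec: "decseq \<kappa>"
  proof (rule decseq_SucI)
    fix n
    show "\<kappa> (Suc n) \<le> \<kappa> n" unfolding \<kappa>_def
      using Kmono[of n "Suc n"] K0[of n] K0[of "Suc n"] by (intro frac_le power_mono) auto
  qed
  have loc: "\<exists>r>0. \<exists>\<delta>. (\<forall>j. majorized q x r (\<lambda>y. Q j y - Q j x) (\<delta> j)) \<and>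
       (\<forall>n. (\<Sum>j\<le>n. \<kappa> j * (\<delta> j)\<^sup>2) \<le> \<eta>)" if \<eta>: "0 < \<eta>" for x \<eta>
  proof -
    obtain l where l: "q (x - c l) < \<rho> / 2" using c[of "\<rho> / 2" x] \<rho> by auto
    have Qx: "majorized q x (\<rho> / 2) (Q j) (M j l)" for j
      by (rule majorized_recentre[OF q, of "c l" "\<rho> / 2"]) (use M \<rho> l in auto)
    define a where "a j = \<kappa> j * (M j l)\<^sup>2" for j
    have a0: "0 \<le> a j" for j using pos[of j] by (simp add: a_def)
    have "a j \<le> (1 / 2) ^ j" if "l \<le> j" for j
    proof -
      have "(M j l)\<^sup>2 \<le> (K j)\<^sup>2" by (intro power_mono MK that M0)
      then have "\<kappa> j * (M j l)\<^sup>2 \<le> \<kappa> j * (K j)\<^sup>2" using pos[of j] by (intro mult_left_mono) auto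
      then show ?thesis using K0[of j] by (simp add: a_def \<kappa>_def)
    qed
    then have sa: "summable a"
      by (intro summable_comparison_test'[OF summable_geometric[of "1 / 2 :: real"], where N = l])
        (use a0 in auto)
    define t where "t = min 1 (\<eta> / (suminf a + 1))"
    have A: "0 \<le> suminf a" by (rule suminf_nonneg[OF sa a0])
    have t: "0 < t" "t \<le> 1" using \<eta> A by (auto simp: t_def)
    have "t * (suminf a + 1) \<le> \<eta> / (suminf a + 1) * (suminf a + 1)"
      using A by (intro mult_right_mono) (auto simp: t_def)
    then have tA: "t * (suminf a + 1) \<le> \<eta>" using A by simp
    define r where "r = t * (\<rho> / 2)"
    have r: "0 < r" "r \<le> \<rho> / 2" using t \<rho> by (auto simp: r_def)
    have "majorized q x r (\<lambda>y. Q j y - Q j x) (t * M j l)" for j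
      using majorized_minus_centre[OF q Qx r] \<rho> by (simp add: r_def)
    moreover have "(\<Sum>j\<le>n. \<kappa> j * (t * M j l)\<^sup>2) \<le> \<eta>" for n
    proof -
      have "(\<Sum>j\<le>n. \<kappa> j * (t * M j l)\<^sup>2) = t\<^sup>2 * (\<Sum>j\<le>n. a j)"
        by (simp add: a_def sum_distrib_left power_mult_distrib mult_ac)
      also have "\<dots> \<le> t * (suminf a + 1)"
      proof (rule mult_mono)
        show "t\<^sup>2 \<le> t" using t by (simp add: power2_eq_square mult_left_le)
        show "(\<Sum>j\<le>n. a j) \<le> suminf a + 1"
          using sum_le_suminf[OF sa, of "{..n}"] a0 by simp
      qed (use t a0 in \<open>auto intro: sum_nonneg\<close>)
      finally show ?thesis using tA by simp
    qed
    ultimately show ?thesis using r(1) by (intro exI[of _ r] conjI exI[of _ "\<lambda>j. t * M j l"]) auto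
  qed
  show ?thesis by (rule that[OF pos le1 dec loc])
qed

text \<open>
  With \<open>s = Q j x - \<xi> j\<close> and an increment of majorant \<open>\<delta>\<close>, the exponent changes by at most
  \<open>2 * \<bar>s\<bar> * \<delta> + \<delta>\<^sup>2 \<le> s\<^sup>2 / 2 + 3 * \<delta>\<^sup>2\<close> in each coordinate. Half of the squared distance survives, and the
  loss \<open>3 * \<eta>\<close> is independent of \<open>n\<close> and \<open>\<xi>\<close>. This is why the bumps are Gaussians: their majorants decay
  like the bumps themselves.
\<close>

lemma majorized_gaussian:
  fixes Q :: "nat \<Rightarrow> 'a::real_vector \<Rightarrow> real"
  assumes q: "is_norm q" and r: "0 < r" and \<kappa>: "\<And>j. 0 \<le> \<kappa> j"
    and Q: "\<And>j. majorized q x r (\<lambda>y. Q j y - Q j x) (\<delta> j)"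
    and \<eta>: "(\<Sum>j\<le>n. \<kappa> j * (\<delta> j)\<^sup>2) \<le> \<eta>" and C: "0 \<le> C"
  shows "majorized q x r (\<lambda>y. exp (C * (a - (\<Sum>j\<le>n. \<kappa> j * (Q j y - \<xi> j)\<^sup>2))))
    (exp (C * (a - (\<Sum>j\<le>n. \<kappa> j * (Q j x - \<xi> j)\<^sup>2) / 2 + 3 * \<eta>)))"
proof -
  define s where "s j = Q j x - \<xi> j" for j
  define D where "D = (\<Sum>j\<le>n. \<kappa> j * (s j)\<^sup>2)"
  define E where "E y = (\<Sum>j\<le>n. (- C * \<kappa> j) *
    (2 * s j * (Q j y - Q j x) + (Q j y - Q j x) * (Q j y - Q j x)))" for y
  have \<delta>0: "0 \<le> \<delta> j" for j using majorized_nonneg[OF Q] r by simp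
  have "majorized q x r E (\<Sum>j\<le>n. (C * \<kappa> j) * (2 * \<bar>s j\<bar> * \<delta> j + \<delta> j * \<delta> j))"
    unfolding E_def
  proof (rule majorized_sum[OF q])
    fix j
    have 1: "majorized q x r (\<lambda>y. 2 * s j * (Q j y - Q j x)) (2 * \<bar>s j\<bar> * \<delta> j)"
      by (rule majorized_linear[OF Q bounded_linear_mult_right]) (use r in \<open>auto simp: abs_mult\<close>)
    have 2: "majorized q x r (\<lambda>y. (Q j y - Q j x) * (Q j y - Q j x)) (\<delta> j * \<delta> j)"
      by (rule majorized_mult[OF Q Q q]) (use r in simp)
    show "majorized q x r (\<lambda>y. (- C * \<kappa> j) * (2 * s j * (Q j y - Q j x) + (Q j y - Q j x) * (Q j y - Q j x)))
        ((C * \<kappa> j) * (2 * \<bar>s j\<bar> * \<delta> j + \<delta> j * \<delta> j))"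
      by (rule majorized_linear[OF majorized_add[OF 1 2 q] bounded_linear_mult_right])
        (use r C \<kappa>[of j] in \<open>auto simp: abs_mult\<close>)
  qed simp
  moreover have "(\<Sum>j\<le>n. (C * \<kappa> j) * (2 * \<bar>s j\<bar> * \<delta> j + \<delta> j * \<delta> j)) \<le> C * (D / 2 + 3 * \<eta>)"
  proof -
    have "2 * \<bar>s j\<bar> * \<delta> j + \<delta> j * \<delta> j \<le> (s j)\<^sup>2 / 2 + 3 * (\<delta> j)\<^sup>2" for j
    proof -
      have "0 \<le> (\<bar>s j\<bar> - 2 * \<delta> j)\<^sup>2" by simp
      then show ?thesis by (simp add: power2_eq_square algebra_simps)
    qed
    then have "(\<Sum>j\<le>n. (C * \<kappa> j) * (2 * \<bar>s j\<bar> * \<delta> j + \<delta> j * \<delta> j)) \<le>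
        (\<Sum>j\<le>n. (C * \<kappa> j) * ((s j)\<^sup>2 / 2 + 3 * (\<delta> j)\<^sup>2))"
      by (intro sum_mono mult_left_mono mult_nonneg_nonneg C \<kappa>)
    also have "\<dots> = C * (D / 2 + 3 * (\<Sum>j\<le>n. \<kappa> j * (\<delta> j)\<^sup>2))"
      by (simp add: D_def sum_distrib_left sum_divide_distrib sum.distrib algebra_simps)
    also have "\<dots> \<le> C * (D / 2 + 3 * \<eta>)" using \<eta> C by (intro mult_left_mono) auto
    finally show ?thesis .
  qed
  ultimately have "majorized q x r E (C * (D / 2 + 3 * \<eta>))" by (rule majorized_mono)
  from majorized_linear[OF majorized_exp[OF this q r] bounded_linear_mult_right[of "exp (C * (a - D))"],
      of "exp (C * (a - D))"]
  have "majorized q x r (\<lambda>y. exp (C * (a - D)) * exp (E y))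
      (exp (C * (a - D)) * exp (C * (D / 2 + 3 * \<eta>)))"
    using r by (simp add: abs_mult)
  moreover have "exp (C * (a - D)) * exp (E y) = exp (C * (a - (\<Sum>j\<le>n. \<kappa> j * (Q j y - \<xi> j)\<^sup>2)))" for y
  proof -
    have "C * (a - D) + E y = C * (a - (D + (\<Sum>j\<le>n. \<kappa> j *
        (2 * s j * (Q j y - Q j x) + (Q j y - Q j x) * (Q j y - Q j x)))))"
      unfolding E_def sum_distrib_left[symmetric] mult.assoc by (simp add: algebra_simps)
    also have "D + (\<Sum>j\<le>n. \<kappa> j * (2 * s j * (Q j y - Q j x) + (Q j y - Q j x) * (Q j y - Q j x))) =
        (\<Sum>j\<le>n. \<kappa> j * (Q j y - \<xi> j)\<^sup>2)"
      unfolding D_def sum.distrib[symmetric]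
      by (rule sum.cong) (simp_all add: s_def power2_eq_square algebra_simps)
    finally show ?thesis by (simp add: exp_add[symmetric])
  qed
  moreover have "exp (C * (a - D)) * exp (C * (D / 2 + 3 * \<eta>)) = exp (C * (a - D / 2 + 3 * \<eta>))"
    by (simp add: exp_add[symmetric] algebra_simps)
  ultimately show ?thesis by (simp add: D_def s_def)
qed

text \<open>
  The bump \<open>g i\<close> is at least \<open>exp (3 * C i * \<rho> i)\<close> where \<open>D i x \<le> \<rho> i\<close>, and at most
  \<open>exp (- 12 * C i * \<rho> i)\<close> where \<open>D i x > 16 * \<rho> i\<close>. Fix \<open>x\<close> and \<open>m\<close> with \<open>D m x \<le> \<rho> m\<close>. A bad index \<open>i < m\<close>
  is beaten by the size of \<open>g m x\<close>, a bad index \<open>i > m\<close> by the smallness of \<open>g i x\<close>; in both cases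
  \<open>norm (f x - y i)\<close> is bounded by \<open>e\<close> and the norms of \<open>y\<close> at indices up to \<open>max i m\<close>, which \<open>C (max i m)\<close> is chosen
  to dominate. The last hypothesis gives \<open>4 * \<rho> i - D i x / 2 + d / 4 \<le> - d / 4\<close> for almost all \<open>i\<close>, which
  makes the series of majorants converge.
\<close>

lemma analytic_blending:
  fixes Q :: "nat \<Rightarrow> 'a::real_vector \<Rightarrow> real" and f :: "'a \<Rightarrow> 'b::banach"
  assumes q: "is_norm q" and \<kappa>: "\<And>j. 0 \<le> \<kappa> j"
    and loc: "\<And>x \<eta>. 0 < \<eta> \<Longrightarrow> \<exists>r>0. \<exists>\<delta>. (\<forall>j. majorized q x r (\<lambda>y. Q j y - Q j x) (\<delta> j)) \<and>
       (\<forall>n. (\<Sum>j\<le>n. \<kappa> j * (\<delta> j)\<^sup>2) \<le> \<eta>)"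
    and D_def: "\<And>i x. D i x = (\<Sum>j\<le>N i. \<kappa> j * (Q j x - \<xi> i j)\<^sup>2)"
    and \<rho>: "\<And>i::nat. 0 < \<rho> i" and e: "0 < e"
    and cover: "\<And>x. \<exists>i. D i x \<le> \<rho> i"
    and small: "\<And>i x. D i x \<le> 16 * \<rho> i \<Longrightarrow> norm (f x - y i) \<le> e"
    and finite: "\<And>x. \<exists>d>0. finite {i. D i x < d + 16 * \<rho> i}"
  shows "\<exists>H. (\<forall>x. \<exists>r M. 0 < r \<and> majorized q x r H M) \<and> (\<forall>x. norm (f x - H x) \<le> 3 * e)"
proof -
  define S where "S i = e + 2 * (\<Sum>j\<le>i. norm (y j))" for i
  have S: "e \<le> S i" for i by (simp add: S_def sum_nonneg)
  have S0: "0 < S i" for i using S[of i] e by linarith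
  \<comment> \<open>The first summand makes the majorants summable against \<open>norm (y i)\<close>, the second gives \<open>2 ^ i * S i / e \<le> exp (C i * \<rho> i)\<close>.\<close>
  define C where "C i = real (i + 1) * (1 + norm (y i)) + 2 ^ i * S i / (e * \<rho> i)" for i
  have C1: "real (i + 1) * (1 + norm (y i)) \<le> C i" for i
    using S0[of i] e \<rho>[of i] by (simp add: C_def)
  have C0: "0 < C i" for i
  proof -
    have "0 < real (i + 1) * (1 + norm (y i))"
      by (intro mult_pos_pos) (auto intro: add_pos_nonneg)
    then show ?thesis using C1[of i] by linarith
  qed
  have Cexp: "2 ^ i * S i / e \<le> exp (C i * \<rho> i)" for i
  proof -
    have "2 ^ i * S i / e = 2 ^ i * S i / (e * \<rho> i) * \<rho> i" using \<rho>[of i] by simp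
    also have "\<dots> \<le> C i * \<rho> i" using \<rho>[of i] by (intro mult_right_mono) (auto simp: C_def)
    also have "\<dots> \<le> exp (C i * \<rho> i)" using exp_ge_add_one_self[of "C i * \<rho> i"] by linarith
    finally show ?thesis .
  qed
  define g where "g i x = exp (C i * (4 * \<rho> i - D i x))" for i x
  define G where "G x = (\<Sum>i. g i x)" for x
  define H where "H x = (\<Sum>i. (g i x * inverse (G x)) *\<^sub>R y i)" for x
  have g0: "0 < g i x" for i x by (simp add: g_def)

  have bump: "\<exists>r>0. \<exists>b. (\<forall>i. majorized q x r (g i) (b i)) \<and> summable (\<lambda>i. b i * (1 + norm (y i)))" for x
  proof -
    obtain d where d: "0 < d" "finite {i. D i x < d + 16 * \<rho> i}" using finite by blast
    have "0 < d / 12" using d(1) by simp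
    from loc[OF this, of x] obtain r \<delta> where r: "0 < r"
      "\<And>j. majorized q x r (\<lambda>y. Q j y - Q j x) (\<delta> j)"
      "\<And>n. (\<Sum>j\<le>n. \<kappa> j * (\<delta> j)\<^sup>2) \<le> d / 12" by auto
    define b where "b i = exp (C i * (4 * \<rho> i - D i x / 2 + 3 * (d / 12)))" for i
    have "majorized q x r (g i) (b i)" for i
      using majorized_gaussian[OF q r(1) \<kappa> r(2) r(3) less_imp_le[OF C0], where a = "4 * \<rho> i" and \<xi> = "\<xi> i" and n = "N i"]
      unfolding g_def[abs_def] b_def D_def .
    moreover have "summable (\<lambda>i. b i * (1 + norm (y i)))"
    proof (rule summable_comparison_test_ev)
      have "\<forall>\<^sub>F i in sequentially. \<not> D i x < d + 16 * \<rho> i"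
        using d(2) by (simp add: cofinite_eq_sequentially[symmetric] eventually_cofinite)
      then show "\<forall>\<^sub>F i in sequentially. norm (b i * (1 + norm (y i))) \<le> 32 / d\<^sup>2 * (1 / real (i + 1) ^ 2)"
      proof eventually_elim
        case (elim i)
        let ?t = "C i * d / 4"
        have t: "0 < ?t" using C0[of i] d(1) by simp
        have "4 * \<rho> i - D i x / 2 + 3 * (d / 12) \<le> - d / 4" using elim \<rho>[of i] by simp
        then have "C i * (4 * \<rho> i - D i x / 2 + 3 * (d / 12)) \<le> C i * (- d / 4)"
          using C0[of i] by (intro mult_left_mono) auto
        then have "b i \<le> exp (- ?t)" by (simp add: b_def)
        also have "\<dots> \<le> 2 / ?t\<^sup>2"
        proof -
          have "?t\<^sup>2 / 2 \<le> exp ?t" using exp_lower_Taylor_quadratic[of ?t] t by linarith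
          then have "inverse (exp ?t) \<le> inverse (?t\<^sup>2 / 2)" using t by (intro le_imp_inverse_le) auto
          then show ?thesis by (simp only: exp_minus inverse_divide)
        qed
        finally have "b i * (1 + norm (y i)) \<le> 2 / ?t\<^sup>2 * (1 + norm (y i))"
          by (intro mult_right_mono) auto
        also have "\<dots> = 32 / d\<^sup>2 * ((1 + norm (y i)) / (C i)\<^sup>2)"
          using C0[of i] d(1) by (simp add: power_mult_distrib power_divide)
        also have "\<dots> \<le> 32 / d\<^sup>2 * (1 / real (i + 1) ^ 2)"
        proof (rule mult_left_mono)
          let ?y = "1 + norm (y i)"
          have y1: "1 \<le> ?y" by simp
          have "real (i + 1) ^ 2 * ?y \<le> real (i + 1) ^ 2 * ?y ^ 2"
            using y1 by (intro mult_left_mono self_le_power) auto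
          also have "\<dots> = (real (i + 1) * ?y)\<^sup>2" by (simp add: power_mult_distrib)
          also have "\<dots> \<le> (C i)\<^sup>2" using y1 by (intro power_mono C1) auto
          finally show "?y / (C i)\<^sup>2 \<le> 1 / real (i + 1) ^ 2"
            using C0[of i] by (simp add: field_simps)
        qed simp
        finally show ?case by (simp add: b_def)
      qed
      show "summable (\<lambda>i. 32 / d\<^sup>2 * (1 / real (i + 1) ^ 2))"
        using inverse_power_summable[of 2, where 'a = real]
        by (intro summable_mult) (simp add: summable_Suc_iff[of "\<lambda>n. 1 / real n ^ 2", symmetric] inverse_eq_divide del: summable_Suc_iff)
    qed
    ultimately show ?thesis using r(1) by (intro exI[of _ r] conjI exI[of _ b]) auto
  qed

  have sg: "summable (\<lambda>i. g i x)" "summable (\<lambda>i. g i x * norm (y i))" for x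
  proof -
    obtain r b where r: "0 < r" "\<And>i. majorized q x r (g i) (b i)" "summable (\<lambda>i. b i * (1 + norm (y i)))"
      using bump[of x] by auto
    have gb: "g i x \<le> b i" for i
      using majorized_norm_centre_le[OF q r(2), of i] r(1) g0[of i x] by simp
    have b0: "0 \<le> b i" for i using gb[of i] g0[of i x] by linarith
    show "summable (\<lambda>i. g i x)"
    proof (rule summable_comparison_test'[OF r(3), where N = 0])
      show "norm (g i x) \<le> b i * (1 + norm (y i))" for i
        using gb[of i] g0[of i x] b0[of i] by (simp add: distrib_left add_increasing2)
    qed
    show "summable (\<lambda>i. g i x * norm (y i))"
    proof (rule summable_comparison_test'[OF r(3), where N = 0])
      show "norm (g i x * norm (y i)) \<le> b i * (1 + norm (y i))" for i
      proof -
        have "g i x * norm (y i) \<le> b i * (1 + norm (y i))"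
          using g0[of i x] by (intro mult_mono gb b0) auto
        then show ?thesis using g0[of i x] by simp
      qed
    qed
  qed
  have G0: "0 < G x" for x
    unfolding G_def by (rule suminf_pos[OF sg(1) g0])

  have analytic: "\<exists>r M. 0 < r \<and> majorized q x r H M" for x
  proof -
    obtain r b where r: "0 < r" "\<And>i. majorized q x r (g i) (b i)" "summable (\<lambda>i. b i * (1 + norm (y i)))"
      using bump[of x] by auto
    have b0: "0 \<le> b i" for i using majorized_nonneg[OF r(2)] r(1) by simp
    have sb: "summable b" "summable (\<lambda>i. b i * norm (y i))"
      by (rule summable_comparison_test'[OF r(3), where N = 0],
          use b0 in \<open>auto simp: distrib_left\<close>)+
    have "majorized q x r G (suminf b)"
      unfolding G_def[abs_def] by (rule majorized_suminf[OF q r(1,2) sb(1)])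
    from majorized_inverse[OF this q r(1)] G0[of x]
    obtain s K where s: "0 < s" "s \<le> r" "majorized q x s (\<lambda>y. inverse (G y)) K" by auto
    have "majorized q x s (\<lambda>x. (g i x * inverse (G x)) *\<^sub>R y i) (norm (y i) * (b i * K))" for i
    proof (rule majorized_linear[OF _ bounded_linear_scaleR_left])
      have "majorized q x s (g i) (b i)"
        by (rule majorized_shrink[OF q r(2)]) (use s in auto)
      then show "majorized q x s (\<lambda>x. g i x * inverse (G x)) (b i * K)"
        by (rule majorized_mult[OF _ s(3) q]) (use s in simp)
    qed (use s in auto)
    moreover have "summable (\<lambda>i. norm (y i) * (b i * K))"
      using summable_mult2[OF sb(2), of K] by (simp add: mult_ac)
    ultimately have "majorized q x s H (\<Sum>i. norm (y i) * (b i * K))"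
      unfolding H_def[abs_def] by (rule majorized_suminf[OF q s(1)])
    then show ?thesis using s(1) by blast
  qed

  have close: "norm (f x - H x) \<le> 3 * e" for x
  proof -
    obtain m where m: "D m x \<le> \<rho> m" using cover by blast
    have fm: "norm (f x - y m) \<le> e" by (rule small) (use m \<rho>[of m] in simp)
    have gm: "exp (C m * \<rho> m) \<le> g m x"
      using m C0[of m] \<rho>[of m] by (simp add: g_def)
    have gm1: "1 \<le> g m x"
      by (rule order_trans[OF _ gm]) (use C0[of m] \<rho>[of m] in simp)
    have key: "g i x * norm (f x - y i) \<le> g i x * e + e * (1 / 2) ^ i * g m x" for i
    proof (cases "D i x \<le> 16 * \<rho> i")
      case True
      then have "g i x * norm (f x - y i) \<le> g i x * e"
        by (intro mult_left_mono small) (use g0[of i x] in auto)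
      moreover have "0 \<le> e * (1 / 2) ^ i * g m x" using e g0[of m x] by simp
      ultimately show ?thesis by linarith
    next
      case False
      then have im: "i \<noteq> m" using m \<rho>[of m] by auto
      have "C i * (4 * \<rho> i - D i x) \<le> C i * (- \<rho> i)"
        using False \<rho>[of i] C0[of i] by (intro mult_left_mono) auto
      then have gi: "g i x \<le> exp (- (C i * \<rho> i))" by (simp add: g_def)
      have nS: "norm (f x - y i) \<le> S k" if "i \<le> k" "m \<le> k" for k
      proof -
        have "norm (y i) \<le> (\<Sum>j\<le>k. norm (y j))" "norm (y m) \<le> (\<Sum>j\<le>k. norm (y j))"
          by (rule member_le_sum; use that in auto)+
        moreover have "norm (f x - y i) \<le> norm (f x - y m) + norm (y m) + norm (y i)"
          using norm_triangle_ineq[of "f x - y m" "y m - y i"] norm_triangle_ineq4[of "y m" "y i"] by simp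
        ultimately show ?thesis using fm by (simp add: S_def)
      qed
      have "g i x * norm (f x - y i) \<le> e * (1 / 2) ^ i * g m x"
      proof (cases "i < m")
        case True
        have "exp (- (C i * \<rho> i)) \<le> 1" using C0[of i] \<rho>[of i] by simp
        then have "g i x \<le> 1" using gi by linarith
        then have "g i x * norm (f x - y i) \<le> 1 * S m"
          by (intro mult_mono nS) (use True in auto)
        also have "\<dots> \<le> e * (1 / 2) ^ m * (2 ^ m * S m / e)"
          using e by (simp add: power_divide)
        also have "\<dots> \<le> e * (1 / 2) ^ i * g m x"
        proof (intro mult_mono)
          show "(1 / 2 :: real) ^ m \<le> (1 / 2) ^ i" using True by (intro power_decreasing) auto
          show "2 ^ m * S m / e \<le> g m x" using Cexp[of m] gm by linarith
        qed (use e S0[of m] in auto)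
        finally show ?thesis .
      next
        case False
        with im have "m < i" by simp
        have "g i x * norm (f x - y i) \<le> exp (- (C i * \<rho> i)) * S i"
          by (intro mult_mono gi nS) (use \<open>m < i\<close> in auto)
        also have "\<dots> \<le> inverse (2 ^ i * S i / e) * S i"
          unfolding exp_minus using S0[of i] e
          by (intro mult_right_mono le_imp_inverse_le Cexp) auto
        also have "\<dots> = e * (1 / 2) ^ i * 1"
          using S0[of i] e by (simp add: field_simps)
        also have "\<dots> \<le> e * (1 / 2) ^ i * g m x"
          using e gm1 by (intro mult_left_mono) auto
        finally show ?thesis .
      qed
      moreover have "0 \<le> g i x * e" using e g0[of i x] by simp
      ultimately show ?thesis by linarith
    qed
    have geo: "summable (\<lambda>i. e * (1 / 2 :: real) ^ i * g m x)"
      by (intro summable_mult summable_mult2 summable_geometric) simp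
    have geoval: "(\<Sum>i. e * (1 / 2 :: real) ^ i * g m x) = 2 * e * g m x"
      using suminf_geometric[of "1 / 2 :: real"]
      by (simp add: suminf_mult suminf_mult2[symmetric] summable_geometric summable_mult)
    have sy: "summable (\<lambda>i. g i x *\<^sub>R y i)"
      by (rule summable_norm_cancel) (use sg(2)[of x] g0[of _ x] in \<open>simp add: less_imp_le\<close>)
    have sgf: "summable (\<lambda>i. g i x *\<^sub>R f x)" by (rule summable_scaleR_left[OF sg(1)])
    have sn: "summable (\<lambda>i. norm (g i x *\<^sub>R (f x - y i)))"
      by (rule summable_comparison_test'[OF summable_add[OF summable_mult2[OF sg(1), of x e] geo], where N = 0])
        (use key g0[of _ x] in \<open>auto simp: less_imp_le abs_of_pos\<close>)
    have HG: "H x = inverse (G x) *\<^sub>R (\<Sum>i. g i x *\<^sub>R y i)"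
      using suminf_scaleR_right[OF sy, of "inverse (G x)"] by (simp add: H_def mult.commute)
    have "G x *\<^sub>R (f x - H x) = (\<Sum>i. g i x *\<^sub>R f x) - (\<Sum>i. g i x *\<^sub>R y i)"
      using G0[of x] unfolding HG by (simp add: scaleR_diff_right G_def suminf_scaleR_left[OF sg(1)])
    also have "\<dots> = (\<Sum>i. g i x *\<^sub>R (f x - y i))"
      by (simp add: suminf_diff[OF sgf sy] scaleR_diff_right)
    finally have "G x * norm (f x - H x) = norm (\<Sum>i. g i x *\<^sub>R (f x - y i))"
      using G0[of x] by (metis abs_of_pos norm_scaleR)
    also have "\<dots> \<le> (\<Sum>i. norm (g i x *\<^sub>R (f x - y i)))" by (rule summable_norm[OF sn])
    also have "\<dots> \<le> (\<Sum>i. g i x * e + e * (1 / 2) ^ i * g m x)"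
      by (rule suminf_le[OF _ sn summable_add[OF summable_mult2[OF sg(1)] geo]])
        (use key g0[of _ x] in \<open>auto simp: less_imp_le abs_of_pos\<close>)
    also have "\<dots> = G x * e + 2 * e * g m x"
      unfolding suminf_add[OF summable_mult2[OF sg(1)] geo, symmetric] geoval
      by (simp add: G_def suminf_mult2[OF sg(1)])
    also have "g m x \<le> G x"
      unfolding G_def using sum_le_suminf[OF sg(1), of "{m}" x] g0[of _ x] by (simp add: less_imp_le)
    finally have "G x * norm (f x - H x) \<le> G x * (3 * e)"
      using e by (simp add: algebra_simps)
    then show ?thesis using G0[of x] by simp
  qed
  show ?thesis using analytic close by blast
qed

section \<open>A locally finite lattice of bumps\<close>

text \<open>
  A lattice point of level \<open>n\<close> is an integer list of length \<open>n + 1\<close>, scaled by the mesh \<open>h n\<close>. The index set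
  \<open>I\<close> keeps those whose last coordinate is below \<open>\<mu>\<close> and whose earlier ones are above \<open>\<mu>\<close>, up to \<open>h n\<close>. A
  point \<open>x\<close> is covered at the level of the first \<open>n\<close> with \<open>Q n x < \<mu>\<close>, by rounding its coordinates. If
  \<open>Q m x < \<mu> - 3 * \<beta>\<close>, coordinate \<open>m\<close> alone keeps \<open>x\<close> away from all lattice points of level above \<open>m\<close>; this
  uses that \<open>\<kappa>\<close>, and with it \<open>\<rho>\<close>, decreases. At each of the levels up to \<open>m\<close> only finitely many lattice
  points are near \<open>x\<close>.
\<close>

lemma lattice_cover:
  fixes Q :: "nat \<Rightarrow> 'x \<Rightarrow> real" and P :: "'x \<Rightarrow> nat \<Rightarrow> bool"
  assumes \<kappa>: "\<And>j. 0 < \<kappa> j" "\<And>j. \<kappa> j \<le> 1" "decseq \<kappa>" and \<beta>: "0 < \<beta>"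
    and cover: "\<And>x. \<exists>j. Q j x < \<mu> - 3 * \<beta>"
    and near: "\<And>j x. Q j x < \<mu> + 3 * \<beta> \<Longrightarrow> P x j"
  obtains N \<xi> \<rho> where
    "\<And>i::nat. 0 < \<rho> i"
    "\<And>x. \<exists>i. (\<Sum>j\<le>N i. \<kappa> j * (Q j x - \<xi> i j)\<^sup>2) \<le> \<rho> i"
    "\<And>i x. (\<Sum>j\<le>N i. \<kappa> j * (Q j x - \<xi> i j)\<^sup>2) \<le> 16 * \<rho> i \<Longrightarrow> P x (N i)"
    "\<And>x. \<exists>d>0. finite {i. (\<Sum>j\<le>N i. \<kappa> j * (Q j x - \<xi> i j)\<^sup>2) < d + 16 * \<rho> i}"
proof -
  \<comment> \<open>The mesh is such that rounding \<open>n + 1\<close> coordinates costs at most \<open>\<rho> n\<close>, and \<open>16 * \<rho> n = \<kappa> n * \<beta>\<^sup>2\<close> keeps coordinate \<open>n\<close> within \<open>\<beta>\<close>.\<close>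
  define h where "h n = \<beta> * sqrt (\<kappa> n / (16 * real (n + 1)))" for n
  define \<rho> where "\<rho> n = \<kappa> n * \<beta>\<^sup>2 / 16" for n
  have h0: "0 < h n" for n using \<kappa>(1)[of n] \<beta> by (simp add: h_def)
  have hsq: "real (n + 1) * (h n)\<^sup>2 = \<rho> n" for n
  proof -
    have "(h n)\<^sup>2 = \<beta>\<^sup>2 * (\<kappa> n / (16 * real (n + 1)))"
      using \<kappa>(1)[of n] by (simp add: h_def power_mult_distrib)
    then show ?thesis by (simp add: \<rho>_def field_simps)
  qed
  have h\<beta>: "h n \<le> \<beta>" for n
  proof -
    have "\<kappa> n / (16 * real (n + 1)) \<le> 1" using \<kappa>(2)[of n] by (simp add: divide_le_eq)
    then have "sqrt (\<kappa> n / (16 * real (n + 1))) \<le> 1" by simp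
    then show ?thesis using \<beta> unfolding h_def by (intro mult_left_le) auto
  qed
  define lv where "lv \<nu> = length \<nu> - 1" for \<nu> :: "int list"
  define pt where "pt \<nu> j = h (lv \<nu>) * of_int (\<nu> ! j)" for \<nu> j
  define D where "D \<nu> x = (\<Sum>j\<le>lv \<nu>. \<kappa> j * (Q j x - pt \<nu> j)\<^sup>2)" for \<nu> x
  define I where "I = {\<nu>. \<nu> \<noteq> [] \<and> (\<forall>j<lv \<nu>. \<mu> - h (lv \<nu>) \<le> pt \<nu> j) \<and> pt \<nu> (lv \<nu>) \<le> \<mu> + h (lv \<nu>)}"
  have term_le: "\<kappa> j * (Q j x - pt \<nu> j)\<^sup>2 \<le> D \<nu> x" if "j \<le> lv \<nu>" for j \<nu> x
    unfolding D_def
    by (rule member_le_sum[where f = "\<lambda>j. \<kappa> j * (Q j x - pt \<nu> j)\<^sup>2"])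
      (use that \<kappa>(1) in \<open>auto simp: less_imp_le\<close>)

  have c1: "\<exists>\<nu>\<in>I. D \<nu> x \<le> \<rho> (lv \<nu>)" for x
  proof -
    obtain j0 where "Q j0 x < \<mu> - 3 * \<beta>" using cover by blast
    then have ex: "Q j0 x < \<mu>" using \<beta> by linarith
    define n where "n = (LEAST j. Q j x < \<mu>)"
    have n: "Q n x < \<mu>" unfolding n_def by (rule LeastI[of _ j0]) (rule ex)
    have below: "\<mu> \<le> Q j x" if "j < n" for j
      using not_less_Least[of j "\<lambda>j. Q j x < \<mu>"] that by (simp add: n_def)
    define \<nu> where "\<nu> = map (\<lambda>j. \<lfloor>Q j x / h n\<rfloor>) [0..<n + 1]"
    have lv: "lv \<nu> = n" by (simp add: lv_def \<nu>_def)
    have pt: "pt \<nu> j \<le> Q j x" "Q j x - h n \<le> pt \<nu> j" if "j \<le> n" for j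
    proof -
      have "\<nu> ! j = \<lfloor>Q j x / h n\<rfloor>"
        using that by (simp add: \<nu>_def del: upt_Suc)
      then have e: "pt \<nu> j = h n * of_int \<lfloor>Q j x / h n\<rfloor>"
        by (simp only: pt_def lv)
      have "h n * of_int \<lfloor>Q j x / h n\<rfloor> \<le> h n * (Q j x / h n)"
        using h0[of n] by (intro mult_left_mono) auto
      then show "pt \<nu> j \<le> Q j x" unfolding e using h0[of n] by simp
      have "h n * (Q j x / h n) \<le> h n * (of_int \<lfloor>Q j x / h n\<rfloor> + 1)"
        using h0[of n] by (intro mult_left_mono) linarith+
      then show "Q j x - h n \<le> pt \<nu> j" unfolding e using h0[of n] by (simp add: algebra_simps)
    qed
    have "\<nu> \<in> I"
      unfolding I_def mem_Collect_eq lv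
    proof (intro conjI allI impI)
      show "\<nu> \<noteq> []" by (simp add: \<nu>_def)
      show "\<mu> - h n \<le> pt \<nu> j" if "j < n" for j
        using pt(2)[of j] below[OF that] that by simp
      show "pt \<nu> n \<le> \<mu> + h n" using pt(1)[of n] n h0[of n] by simp
    qed
    moreover have "D \<nu> x \<le> \<rho> (lv \<nu>)"
    proof -
      have "D \<nu> x \<le> (\<Sum>j\<le>n. (h n)\<^sup>2)"
        unfolding D_def lv
      proof (rule sum_mono)
        fix j assume "j \<in> {..n}"
        then have "\<bar>Q j x - pt \<nu> j\<bar> \<le> h n" using pt[of j] h0[of n] by auto
        then have "(Q j x - pt \<nu> j)\<^sup>2 \<le> (h n)\<^sup>2" by (metis abs_ge_zero power2_abs power_mono)
        then have "\<kappa> j * (Q j x - pt \<nu> j)\<^sup>2 \<le> 1 * (h n)\<^sup>2"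
          using \<kappa>(2)[of j] by (intro mult_mono) auto
        then show "\<kappa> j * (Q j x - pt \<nu> j)\<^sup>2 \<le> (h n)\<^sup>2" by simp
      qed
      also have "\<dots> = \<rho> n" using hsq[of n] by (simp add: algebra_simps)
      finally show ?thesis by (simp add: lv)
    qed
    ultimately show ?thesis by blast
  qed

  have c2: "P x (lv \<nu>)" if "\<nu> \<in> I" "D \<nu> x \<le> 16 * \<rho> (lv \<nu>)" for \<nu> x
  proof (rule near)
    let ?n = "lv \<nu>"
    have "\<kappa> ?n * (Q ?n x - pt \<nu> ?n)\<^sup>2 \<le> \<kappa> ?n * \<beta>\<^sup>2"
      using term_le[of ?n \<nu> x] that(2) by (simp add: \<rho>_def)
    then have "(Q ?n x - pt \<nu> ?n)\<^sup>2 \<le> \<beta>\<^sup>2" using \<kappa>(1)[of ?n] by simp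
    then have "Q ?n x - pt \<nu> ?n \<le> \<beta>" by (rule power2_le_imp_le) (use \<beta> in simp)
    moreover have "pt \<nu> ?n \<le> \<mu> + h ?n" using that(1) by (simp add: I_def)
    ultimately show "Q ?n x < \<mu> + 3 * \<beta>" using h\<beta>[of ?n] \<beta> by linarith
  qed

  have c3: "\<exists>d>0. finite {\<nu> \<in> I. D \<nu> x < d + 16 * \<rho> (lv \<nu>)}" for x
  proof -
    obtain m where m: "Q m x < \<mu> - 3 * \<beta>" using cover by blast
    define d where "d = \<kappa> m * \<beta>\<^sup>2"
    have d0: "0 < d" using \<kappa>(1)[of m] \<beta> by (simp add: d_def)
    define B where "B = \<lceil>\<Sum>n\<le>m. \<Sum>j\<le>m. (\<bar>Q j x\<bar> + 1 + 2 * \<beta>\<^sup>2 / \<kappa> j) / h n\<rceil>"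
    have "{\<nu> \<in> I. D \<nu> x < d + 16 * \<rho> (lv \<nu>)} \<subseteq> {\<nu>. set \<nu> \<subseteq> {- B..B} \<and> length \<nu> \<le> m + 1}"
    proof
      fix \<nu> assume "\<nu> \<in> {\<nu> \<in> I. D \<nu> x < d + 16 * \<rho> (lv \<nu>)}"
      then have \<nu>: "\<nu> \<in> I" "D \<nu> x < d + 16 * \<rho> (lv \<nu>)" by auto
      let ?n = "lv \<nu>"
      have len: "length \<nu> = ?n + 1" using \<nu>(1) by (auto simp: I_def lv_def)
      have nm: "?n \<le> m"
      proof (rule ccontr)
        assume "\<not> ?n \<le> m"
        then have mn: "m < ?n" by simp
        then have "\<mu> - h ?n \<le> pt \<nu> m" using \<nu>(1) by (simp add: I_def)
        then have "2 * \<beta> \<le> pt \<nu> m - Q m x" using m h\<beta>[of ?n] by linarith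
        then have "(2 * \<beta>)\<^sup>2 \<le> (pt \<nu> m - Q m x)\<^sup>2" using \<beta> by (intro power_mono) auto
        then have "4 * \<beta>\<^sup>2 \<le> (Q m x - pt \<nu> m)\<^sup>2" by (simp add: power2_commute power_mult_distrib)
        then have "\<kappa> m * (4 * \<beta>\<^sup>2) \<le> \<kappa> m * (Q m x - pt \<nu> m)\<^sup>2"
          using \<kappa>(1)[of m] by (intro mult_left_mono) auto
        also have "\<dots> \<le> D \<nu> x" by (rule term_le) (use mn in simp)
        finally have "4 * d \<le> D \<nu> x" by (simp add: d_def)
        moreover have "16 * \<rho> ?n \<le> d"
          using decseqD[OF \<kappa>(3), of m ?n] mn by (simp add: \<rho>_def d_def mult_right_mono)
        ultimately show False using \<nu>(2) d0 by linarith
      qed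
      have "- B \<le> \<nu> ! j \<and> \<nu> ! j \<le> B" if j: "j \<le> ?n" for j
      proof -
        let ?z = "\<bar>Q j x - pt \<nu> j\<bar>" and ?c = "2 * \<beta>\<^sup>2 / \<kappa> j"
        have c0: "0 \<le> ?c" using \<kappa>(1)[of j] by simp
        have "d + 16 * \<rho> ?n \<le> 2 * \<beta>\<^sup>2"
          using mult_right_mono[OF \<kappa>(2)[of m], of "\<beta>\<^sup>2"] mult_right_mono[OF \<kappa>(2)[of ?n], of "\<beta>\<^sup>2"]
          by (simp add: d_def \<rho>_def)
        then have "\<kappa> j * ?z\<^sup>2 < 2 * \<beta>\<^sup>2"
          using term_le[OF j, of x] \<nu>(2) by simp
        then have z: "?z\<^sup>2 < ?c" using \<kappa>(1)[of j] by (simp add: field_simps)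
        have "?z \<le> 1 + ?c"
        proof (rule ccontr)
          assume "\<not> ?z \<le> 1 + ?c"
          then have "1 * ?c < ?z * ?z" using c0 by (intro mult_strict_mono) auto
          then show False using z by (simp add: power2_eq_square)
        qed
        then have "\<bar>pt \<nu> j\<bar> \<le> \<bar>Q j x\<bar> + 1 + ?c" by linarith
        then have "\<bar>of_int (\<nu> ! j)\<bar> \<le> (\<bar>Q j x\<bar> + 1 + ?c) / h ?n"
          using h0[of ?n] by (simp add: pt_def abs_mult field_simps)
        also have "\<dots> \<le> (\<Sum>j\<le>m. (\<bar>Q j x\<bar> + 1 + 2 * \<beta>\<^sup>2 / \<kappa> j) / h ?n)"
          by (rule member_le_sum[where f = "\<lambda>j. (\<bar>Q j x\<bar> + 1 + 2 * \<beta>\<^sup>2 / \<kappa> j) / h ?n"])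
            (use j nm h0 \<kappa>(1) in \<open>auto simp: less_imp_le intro!: divide_nonneg_pos add_nonneg_nonneg\<close>)
        also have "\<dots> \<le> (\<Sum>n\<le>m. \<Sum>j\<le>m. (\<bar>Q j x\<bar> + 1 + 2 * \<beta>\<^sup>2 / \<kappa> j) / h n)"
          by (rule member_le_sum[where f = "\<lambda>n. \<Sum>j\<le>m. (\<bar>Q j x\<bar> + 1 + 2 * \<beta>\<^sup>2 / \<kappa> j) / h n"])
            (use nm h0 \<kappa>(1) in \<open>auto simp: less_imp_le intro!: sum_nonneg divide_nonneg_pos add_nonneg_nonneg\<close>)
        also have "\<dots> \<le> of_int B" unfolding B_def by (rule le_of_int_ceiling)
        finally have "\<bar>\<nu> ! j\<bar> \<le> B" by (simp flip: of_int_abs)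
        then show ?thesis by linarith
      qed
      then have "set \<nu> \<subseteq> {- B..B}" using len by (auto simp: in_set_conv_nth less_Suc_eq_le)
      then show "\<nu> \<in> {\<nu>. set \<nu> \<subseteq> {- B..B} \<and> length \<nu> \<le> m + 1}" using len nm by simp
    qed
    moreover have "finite {\<nu>. set \<nu> \<subseteq> {- B..B} \<and> length \<nu> \<le> m + 1}"
      by (rule finite_lists_length_le) simp
    ultimately show ?thesis using d0 finite_subset by blast
  qed

  have inf: "infinite I"
  proof -
    have "range (\<lambda>k::nat. [\<lfloor>\<mu> / h 0\<rfloor> - int k]) \<subseteq> I"
    proof
      fix \<nu> assume "\<nu> \<in> range (\<lambda>k::nat. [\<lfloor>\<mu> / h 0\<rfloor> - int k])"
      then obtain k where \<nu>: "\<nu> = [\<lfloor>\<mu> / h 0\<rfloor> - int k]" by blast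
      have "of_int (\<lfloor>\<mu> / h 0\<rfloor> - int k) \<le> \<mu> / h 0"
        unfolding of_int_diff of_int_of_nat_eq using of_int_floor_le[of "\<mu> / h 0"] by linarith
      then have "h 0 * of_int (\<lfloor>\<mu> / h 0\<rfloor> - int k) \<le> h 0 * (\<mu> / h 0)"
        using h0[of 0] by (intro mult_left_mono) auto
      then show "\<nu> \<in> I" using h0[of 0] by (simp add: \<nu> I_def lv_def pt_def)
    qed
    moreover have "infinite (range (\<lambda>k::nat. [\<lfloor>\<mu> / h 0\<rfloor> - int k]))"
      by (rule range_inj_infinite) (simp add: inj_on_def)
    ultimately show ?thesis using finite_subset by blast
  qed
  define en where "en = from_nat_into I"
  have bij: "bij_betw en UNIV I"
    unfolding en_def by (rule bij_betw_from_nat_into[OF countableI_type inf])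
  then have en: "en i \<in> I" for i by (auto simp: bij_betw_def)
  show ?thesis
  proof (rule that[where N = "\<lambda>i. lv (en i)" and \<xi> = "\<lambda>i. pt (en i)" and \<rho> = "\<lambda>i. \<rho> (lv (en i))"])
    show "0 < \<rho> (lv (en i))" for i using \<kappa>(1) \<beta> by (simp add: \<rho>_def)
    show "\<exists>i. (\<Sum>j\<le>lv (en i). \<kappa> j * (Q j x - pt (en i) j)\<^sup>2) \<le> \<rho> (lv (en i))" for x
    proof -
      obtain \<nu> where \<nu>: "\<nu> \<in> I" "D \<nu> x \<le> \<rho> (lv \<nu>)" using c1 by blast
      have "\<nu> \<in> range en" using bij \<nu>(1) by (simp add: bij_betw_def)
      then obtain i where "\<nu> = en i" by blast
      with \<nu>(2) have "D (en i) x \<le> \<rho> (lv (en i))" by simp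
      then show ?thesis unfolding D_def by (rule exI[of _ i])
    qed
    show "P x (lv (en i))"
      if "(\<Sum>j\<le>lv (en i). \<kappa> j * (Q j x - pt (en i) j)\<^sup>2) \<le> 16 * \<rho> (lv (en i))" for i x
      using c2[OF en] that unfolding D_def .
    show "\<exists>d>0. finite {i. (\<Sum>j\<le>lv (en i). \<kappa> j * (Q j x - pt (en i) j)\<^sup>2) < d + 16 * \<rho> (lv (en i))}" for x
    proof -
      obtain d where d: "0 < d" "finite {\<nu> \<in> I. D \<nu> x < d + 16 * \<rho> (lv \<nu>)}" using c3 by blast
      have "finite (en -` {\<nu> \<in> I. D \<nu> x < d + 16 * \<rho> (lv \<nu>)})"
        by (rule finite_vimageI[OF d(2)]) (use bij in \<open>simp add: bij_betw_def\<close>)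
      moreover have "en -` {\<nu> \<in> I. D \<nu> x < d + 16 * \<rho> (lv \<nu>)} = {i. D (en i) x < d + 16 * \<rho> (lv (en i))}"
        using en by auto
      ultimately have "finite {i. D (en i) x < d + 16 * \<rho> (lv (en i))}" by simp
      with d(1) show ?thesis unfolding D_def by (intro exI[of _ d] conjI)
    qed
  qed
qed

section \<open>Approximation on a normed space and the theorem\<close>

text \<open>
  The scaling factor is \<open>l = 2 / d\<close>, since from
  \<open>q (a + l *\<^sub>R (x - c j)) < 1\<close> and \<open>q a < 1\<close> it follows that \<open>q (x - c j) < d\<close>. The interval from \<open>Q a\<close> to \<open>\<alpha>\<close>
  is divided into seven parts: six separate the thresholds \<open>\<mu> - 3 * \<beta>\<close> and \<open>\<mu> + 3 * \<beta> = \<alpha>\<close>, and one leaves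
  room for the continuity of \<open>Q\<close> at \<open>a\<close>.
\<close>

lemma normed_analytic_approximation:
  fixes f :: "'a::real_vector \<Rightarrow> 'b::banach"
  assumes q: "is_norm q" and c: "\<And>x e. 0 < e \<Longrightarrow> \<exists>l::nat. q (x - c l) < e"
    and Q: "uniformly_analytic_separating q Q"
    and d: "0 < d" "\<And>x y. q (x - y) < d \<Longrightarrow> norm (f x - f y) \<le> e" and e: "0 < e"
  shows "\<exists>H. (\<forall>x. \<exists>r M. 0 < r \<and> majorized q x r H M) \<and> (\<forall>x. norm (f x - H x) \<le> 3 * e)"
proof -
  obtain R where "0 < R" "analytic_map (mtopology_of (norm_metric q)) Q"
    "\<And>x. \<exists>P. power_series_at (mtopology_of (norm_metric q)) Q x P \<and> ereal R \<le> convergence_radius q P"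
    using Q unfolding uniformly_analytic_separating_def by blast
  from uniformly_analytic_majorized[OF q this(2,1,3)]
  obtain \<rho> where \<rho>: "0 < \<rho>" "\<And>x. \<exists>M. majorized q x \<rho> Q M" by blast
  obtain \<alpha> a where \<alpha>: "Q a < \<alpha>" "\<And>x. Q x < \<alpha> \<Longrightarrow> q x < 1"
    using Q unfolding uniformly_analytic_separating_def by blast
  define l where "l = 2 / d"
  have l: "0 < l" using d by (simp add: l_def)
  define Qs where "Qs j x = Q (a + l *\<^sub>R (x - c j))" for j x
  define \<beta> where "\<beta> = (\<alpha> - Q a) / 7"
  define \<mu> where "\<mu> = \<alpha> - 3 * \<beta>"
  have \<beta>: "0 < \<beta>" "\<mu> - 3 * \<beta> = Q a + \<beta>" using \<alpha>(1) by (auto simp: \<beta>_def \<mu>_def field_simps)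
  have maj: "\<exists>M. majorized q x (\<rho> / l) (Qs j) M" for j x
    unfolding Qs_def[abs_def] using majorized_affine[OF q l] \<rho>(2) by blast
  have \<rho>l: "0 < \<rho> / l" using \<rho> l by simp
  have cover: "\<exists>j. Qs j x < \<mu> - 3 * \<beta>" for x
  proof -
    obtain M where "majorized q a \<rho> Q M" using \<rho>(2) by blast
    from majorized_continuous_at[OF q this \<rho>(1) half_gt_zero[OF \<beta>(1)]]
    obtain s where s: "0 < s" "\<And>y. q (y - a) \<le> s \<Longrightarrow> \<bar>Q y - Q a\<bar> \<le> \<beta> / 2" by auto
    obtain j where j: "q (x - c j) < s / l" using c[of "s / l" x] s(1) l by auto
    have "q (a + l *\<^sub>R (x - c j) - a) \<le> s"
      using j l by (simp add: is_norm_scale[OF q] pos_less_divide_eq mult.commute)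
    from s(2)[OF this] have "Qs j x < \<mu> - 3 * \<beta>" using \<beta> unfolding Qs_def by linarith
    then show ?thesis by blast
  qed
  have near: "norm (f x - f (c j)) \<le> e" if "Qs j x < \<mu> + 3 * \<beta>" for j x
  proof (rule d(2))
    have "q (a + l *\<^sub>R (x - c j)) < 1" using that by (intro \<alpha>(2)) (simp add: Qs_def \<mu>_def)
    moreover have "q (l *\<^sub>R (x - c j)) \<le> q (a + l *\<^sub>R (x - c j)) + q a"
      using is_norm_triangle[OF q, of "a + l *\<^sub>R (x - c j)" a 0] is_norm_minus_commute[OF q, of 0 a]
        is_norm_add[OF q, of "a + l *\<^sub>R (x - c j)" "- a"] is_norm_scale[OF q, of "- 1" a] by simp
    moreover have "q a < 1" using \<alpha> by simp
    ultimately have "l * q (x - c j) < 2" using l by (simp add: is_norm_scale[OF q])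
    then show "q (x - c j) < d" using d(1) by (simp add: l_def field_simps)
  qed
  show ?thesis
  proof (rule square_summing_weights[OF q c \<rho>l maj])
    fix \<kappa>
    assume \<kappa>: "\<And>j. 0 < \<kappa> j" "\<And>j. \<kappa> j \<le> 1" "decseq \<kappa>"
      and loc: "\<And>x \<eta>. 0 < \<eta> \<Longrightarrow> \<exists>r>0. \<exists>\<delta>. (\<forall>j. majorized q x r (\<lambda>y. Qs j y - Qs j x) (\<delta> j)) \<and>
         (\<forall>n. (\<Sum>j\<le>n. \<kappa> j * (\<delta> j)\<^sup>2) \<le> \<eta>)"
    show ?thesis
    proof (rule lattice_cover[OF \<kappa> \<beta>(1) cover near])
      fix N \<xi> \<rho>'
      assume ind: "\<And>i::nat. 0 < \<rho>' i"
        "\<And>x. \<exists>i. (\<Sum>j\<le>N i. \<kappa> j * (Qs j x - \<xi> i j)\<^sup>2) \<le> \<rho>' i"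
        "\<And>i x. (\<Sum>j\<le>N i. \<kappa> j * (Qs j x - \<xi> i j)\<^sup>2) \<le> 16 * \<rho>' i \<Longrightarrow> norm (f x - f (c (N i))) \<le> e"
        "\<And>x. \<exists>d>0. finite {i. (\<Sum>j\<le>N i. \<kappa> j * (Qs j x - \<xi> i j)\<^sup>2) < d + 16 * \<rho>' i}"
      show ?thesis
        by (rule analytic_blending[OF q less_imp_le[OF \<kappa>(1)] loc refl ind(1) e ind(2) ind(3) ind(4)])
    qed
  qed
qed

lemma norm_topology_coarser:
  assumes q: "is_norm q" and T: "vector_topology T" and cont: "continuous_map T euclideanreal q"
    and U: "openin (mtopology_of (norm_metric q)) U"
  shows "openin T U"
proof -
  have top: "topspace T = UNIV" using T by (simp add: vector_topology_def)
  have ball: "openin T {y. q (y - x) < r}" for x r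
  proof -
    have "continuous_map T (prod_topology T T) (\<lambda>y. (y, - x))"
      by (intro continuous_map_pairedI continuous_map_id[unfolded id_def]) (simp add: top)
    from continuous_map_compose[OF this, of T "\<lambda>(x, y). x + y"] T
    have "continuous_map T T (\<lambda>y. y - x)" by (simp add: vector_topology_def o_def)
    from continuous_map_compose[OF this cont]
    have "continuous_map T euclideanreal (\<lambda>y. q (y - x))" by (simp add: o_def)
    from openin_continuous_map_preimage[OF this, of "{..<r}"] show ?thesis by (simp add: top)
  qed
  show ?thesis
  proof (subst openin_subopen, intro ballI)
    fix x assume "x \<in> U"
    then obtain r where r: "0 < r" "\<And>y. q (y - x) < r \<Longrightarrow> y \<in> U"
      using U unfolding openin_norm_topology[OF q] by blast
    have "x \<in> {y. q (y - x) < r}" using r(1) by (simp add: is_norm_zero[OF q])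
    then show "\<exists>V. openin T V \<and> x \<in> V \<and> V \<subseteq> U" using ball[of x r] r(2) by blast
  qed
qed

lemma separable_norm_dense_sequence:
  assumes q: "is_norm q" and T: "vector_topology T" and cont: "continuous_map T euclideanreal q"
    and sep: "separable_space T"
  obtains c :: "nat \<Rightarrow> 'a::real_vector" where "\<And>x e. 0 < e \<Longrightarrow> \<exists>l. q (x - c l) < e"
proof -
  have top: "topspace T = UNIV" using T by (simp add: vector_topology_def)
  obtain S where S: "countable S" "T closure_of S = UNIV"
    using sep unfolding separable_space_def top by blast
  have dense: "\<exists>y\<in>S. q (x - y) < e" if "0 < e" for x e
  proof -
    have "openin (mtopology_of (norm_metric q)) {y. q (y - x) < e}"
      unfolding openin_norm_topology[OF q]
    proof
      fix y assume y: "y \<in> {y. q (y - x) < e}"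
      have "q (z - x) < e" if "q (z - y) < e - q (y - x)" for z
        using is_norm_triangle[OF q, of z x y] that by simp
      then show "\<exists>r>0. \<forall>z. q (z - y) < r \<longrightarrow> z \<in> {y. q (y - x) < e}"
        using y by (intro exI[of _ "e - q (y - x)"]) auto
    qed
    then have "openin T {y. q (y - x) < e}" by (rule norm_topology_coarser[OF q T cont])
    moreover have "x \<in> {y. q (y - x) < e}" using that by (simp add: is_norm_zero[OF q])
    ultimately have U: "x \<in> {y. q (y - x) < e} \<and> openin T {y. q (y - x) < e}" by blast
    have "\<forall>U. x \<in> U \<and> openin T U \<longrightarrow> (\<exists>y. y \<in> S \<and> y \<in> U)"
      using S(2) in_closure_of[of x T S] by simp
    from this[rule_format, OF U] obtain y where "y \<in> S" "q (y - x) < e" by blast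
    then show ?thesis using is_norm_minus_commute[OF q, of x y] by (intro bexI[of _ y]) simp_all
  qed
  have "S \<noteq> {}" using dense[OF zero_less_one] by blast
  then have ran: "range (from_nat_into S) = S" using S(1) by (rule range_from_nat_into)
  show ?thesis
  proof (rule that)
    fix x and e :: real assume "0 < e"
    then obtain y where "y \<in> range (from_nat_into S)" "q (x - y) < e"
      using dense unfolding ran by blast
    then show "\<exists>l. q (x - from_nat_into S l) < e" by blast
  qed
qed

theorem mainTheorem2:
  fixes T :: "'a::real_vector topology"
    and p :: "nat \<Rightarrow> 'a \<Rightarrow> real"
    and f :: "'a \<Rightarrow> 'b::banach"
  assumes "frechet_space T"
    and "frechet_norm_system T p"
    and "separable_space T"
    and "\<forall>n. \<exists>Q. uniformly_analytic_separating (p n) Q"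
    and "uniformly_continuous_map (frechet_metric p) euclidean_metric f"
    and "\<exists>k. uniformly_continuous_map (norm_metric (p k)) euclidean_metric f"
  shows "\<forall>\<epsilon>>0. \<exists>H :: 'a \<Rightarrow> 'b. analytic_map T H \<and> (\<forall>x. norm (f x - H x) < \<epsilon>)"
proof (intro allI impI)
  fix \<epsilon> :: real assume \<epsilon>: "0 < \<epsilon>"
  obtain k where f: "uniformly_continuous_map (norm_metric (p k)) euclidean_metric f"
    using assms(6) by blast
  have q: "is_norm (p k)" and cont: "continuous_map T euclideanreal (p k)"
    using assms(2) by (auto simp: frechet_norm_system_def)
  have T: "vector_topology T" using assms(1) by (simp add: frechet_space_def)
  obtain Q where Q: "uniformly_analytic_separating (p k) Q" using assms(4) by blast
  have mspace: "mspace (norm_metric (p k)) = UNIV"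
    unfolding norm_metric_def by (rule Metric_space.mspace_metric[OF Metric_space_norm[OF q]])
  have "\<exists>d>0. \<forall>x y. p k (y - x) < d \<longrightarrow> dist (f y) (f x) < \<epsilon> / 4"
    using f \<epsilon> unfolding uniformly_continuous_map_def mspace mdist_norm_metric[OF q]
    by (auto dest!: spec[of _ "\<epsilon> / 4"])
  then obtain d where d: "0 < d" "\<And>x y. p k (x - y) < d \<Longrightarrow> norm (f x - f y) \<le> \<epsilon> / 4"
    by (auto simp: dist_norm less_imp_le)
  show "\<exists>H. analytic_map T H \<and> (\<forall>x. norm (f x - H x) < \<epsilon>)"
  proof (rule separable_norm_dense_sequence[OF q T cont assms(3)])
    fix c :: "nat \<Rightarrow> 'a" assume c: "\<And>x e. 0 < e \<Longrightarrow> \<exists>l. p k (x - c l) < e"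
    have "\<exists>H. (\<forall>x. \<exists>r M. 0 < r \<and> majorized (p k) x r H M) \<and>
        (\<forall>x. norm (f x - H x) \<le> 3 * (\<epsilon> / 4))"
      by (rule normed_analytic_approximation[where q = "p k" and c = c and Q = Q and d = d, OF q c Q d])
        (use \<epsilon> in simp_all)
    then obtain H where H: "\<forall>x. \<exists>r M. 0 < r \<and> majorized (p k) x r H M"
      "\<forall>x. norm (f x - H x) \<le> 3 * (\<epsilon> / 4)" by (elim exE conjE)
    have "analytic_map T H"
      by (rule majorized_imp_analytic_map[OF q _ norm_topology_coarser[OF q T cont] spec[OF H(1)]])
        (use T in \<open>simp_all add: vector_topology_def\<close>)
    moreover have "norm (f x - H x) < \<epsilon>" for x using spec[OF H(2), of x] \<epsilon> by linarith
    ultimately show ?thesis by (intro exI[of _ H] conjI allI)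
  qed
qed

end
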